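(* $A_{0}+AP_{+}$ is a Hermite ring.
   Context: $\mathbb{C}_{\geq 0}=\{s\in\mathbb{C}:\operatorname{Re}(s)\geq 0\}$ and $\mathbb{C}_{>0}=\{s\in\mathbb{C}:\operatorname{Re}(s)>0\}$. $A_{0}$ is the set of functions $f:\mathbb{C}_{\geq 0}\to\mathbb{C}$ that are holomorphic in $\mathbb{C}_{>0}$, continuous on $\mathbb{C}_{\geq 0}$, and satisfy $\lim_{s\to\infty}f(s)=0$ (limit as $|s|\to\infty$ in $\mathbb{C}_{\geq 0}$). $AP_{+}$ (causal almost periodic functions) is the closure, in the supremum norm on $\mathbb{C}_{\geq 0}$, of the complex linear span of the functions $s\mapsto e^{-st}$, $t\geq 0$. $A_{0}+AP_{+}=\{f:\mathbb{C}_{\geq 0}\to\mathbb{C}: f=f_{A_0}+f_{AP_+},\ f_{A_0}\in A_0,\ f_{AP_+}\in AP_+\}$ is a Banach algebra with pointwise operations and the supremum norm. Let $R$ be a ring with identity. A matrix $f\in R^{n\times k}$ is left invertible if there exists $g\in R^{k\times n}$ with $gf=I_k$. The ring $R$ is a Hermite ring if for all $k,n\in\mathbb{N}$ with $k<n$ and all left invertible matrices $f\in R^{n\times k}$ there exist $F,G\in R^{n\times n}$ such that $GF=I_n$ and $F_{ij}=f_{ij}$ for all $i\in\{1,\dots,n\}$, $j\in\{1,\dots,k\}$. *)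

theory Defs
  imports
    "HOL-Complex_Analysis.Complex_Analysis"
    "HOL-Algebra.Ring"
    "Jordan_Normal_Form.Matrix"
begin

text \<open>
  Matrices over a ring given by a HOL-Algebra record. The type of matrices is the one of
  Jordan_Normal_Form; its arithmetic refers to type-class operations on the entries, so the product
  and the identity are defined here from the operations of the record.
\<close>

definition matrices_over :: "('a, 'm) ring_scheme \<Rightarrow> nat \<Rightarrow> nat \<Rightarrow> 'a mat set" where
  "matrices_over R n k = {A \<in> carrier_mat n k. elements_mat A \<subseteq> carrier R}"

definition mat_mult_over :: "('a, 'm) ring_scheme \<Rightarrow> 'a mat \<Rightarrow> 'a mat \<Rightarrow> 'a mat" where
  "mat_mult_over R A B =
     mat (dim_row A) (dim_col B)
       (\<lambda>(i, j). finsum R (\<lambda>l. A $$ (i, l) \<otimes>\<^bsub>R\<^esub> B $$ (l, j)) {0..<dim_col A})"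

definition mat_one_over :: "('a, 'm) ring_scheme \<Rightarrow> nat \<Rightarrow> 'a mat" where
  "mat_one_over R n = mat n n (\<lambda>(i, j). if i = j then \<one>\<^bsub>R\<^esub> else \<zero>\<^bsub>R\<^esub>)"

definition left_invertible_over :: "('a, 'm) ring_scheme \<Rightarrow> nat \<Rightarrow> nat \<Rightarrow> 'a mat \<Rightarrow> bool" where
  "left_invertible_over R n k f \<longleftrightarrow>
     f \<in> matrices_over R n k \<and>
     (\<exists>g \<in> matrices_over R k n. mat_mult_over R g f = mat_one_over R k)"

text \<open>
  Rings in HOL-Algebra have an identity. Indices of matrix entries start at 0. The case \<open>k = 0\<close>,
  which is included, holds in every ring (take \<open>F\<close> and \<open>G\<close> to be the identity).
\<close>

definition hermite_ring :: "('a, 'm) ring_scheme \<Rightarrow> bool" where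
  "hermite_ring R \<longleftrightarrow>
     ring R \<and>
     (\<forall>k n f. k < n \<longrightarrow> left_invertible_over R n k f \<longrightarrow>
        (\<exists>F \<in> matrices_over R n n. \<exists>G \<in> matrices_over R n n.
           mat_mult_over R G F = mat_one_over R n \<and>
           (\<forall>i < n. \<forall>j < k. F $$ (i, j) = f $$ (i, j))))"

definition closed_rhp :: "complex set" where
  "closed_rhp = {s. Re s \<ge> 0}"

definition open_rhp :: "complex set" where
  "open_rhp = {s. Re s > 0}"

text \<open>
  A function with the domain \<^const>\<open>closed_rhp\<close> is an extensional function (with the
  fixed value \<^const>\<open>undefined\<close> outside), so that such functions are equal iff they
  agree on \<^const>\<open>closed_rhp\<close>.
\<close>

definition A0 :: "(complex \<Rightarrow> complex) set" where
  "A0 = {f \<in> extensional closed_rhp.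
           f holomorphic_on open_rhp \<and>
           continuous_on closed_rhp f \<and>
           (f \<longlongrightarrow> 0) (inf at_infinity (principal closed_rhp))}"

definition causal_exp_span :: "(complex \<Rightarrow> complex) set" where
  "causal_exp_span =
     {restrict (\<lambda>s. \<Sum>t\<in>T. c t * exp (- (s * complex_of_real t))) closed_rhp | T c.
        finite T \<and> T \<subseteq> {0..}}"

text \<open>
  \<^const>\<open>funspace\<close> is the metric space of bounded extensional functions on
  a set with the supremum distance. Uniform limits of bounded functions are bounded, so restricting
  to bounded functions does not change the closure.
\<close>

definition AP_plus :: "(complex \<Rightarrow> complex) set" where
  "AP_plus = mtopology_of (funspace closed_rhp euclidean_metric) closure_of causal_exp_span"

definition A0_AP_plus :: "(complex \<Rightarrow> complex) set" where
  "A0_AP_plus = {restrict (\<lambda>s. f s + g s) closed_rhp | f g. f \<in> A0 \<and> g \<in> AP_plus}"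

definition A0_AP_plus_ring :: "(complex \<Rightarrow> complex) ring" where
  "A0_AP_plus_ring =
     \<lparr>carrier = A0_AP_plus,
      mult = (\<lambda>f g. restrict (\<lambda>s. f s * g s) closed_rhp),
      one = restrict (\<lambda>s. 1) closed_rhp,
      zero = restrict (\<lambda>s. 0) closed_rhp,
      add = (\<lambda>f g. restrict (\<lambda>s. f s + g s) closed_rhp)\<rparr>"

end

theory Submission
  imports Defs "Jordan_Normal_Form.Determinant"
begin

text \<open>
  Translation to the right, \<open>f\<^sub>\<tau>(s) = f(s + \<tau>)\<close> for \<open>\<tau> \<ge> 0\<close>, maps \<open>A\<^sub>0 + AP\<^sub>+\<close> to
  itself and is multiplicative. It is continuous in \<open>\<tau>\<close> for the supremum norm, because all functions
  of the ring are uniformly continuous on the closed half plane, and as \<open>\<tau> \<rightarrow> \<infinity>\<close> it contracts the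
  ring to the constants: \<open>e\<^sup>-\<^sup>(\<^sup>s\<^sup>+\<^sup>\<tau>\<^sup>)\<^sup>t\<close> tends uniformly to \<open>0\<close> if \<open>t > 0\<close>, and so do the translates
  of a function that vanishes at infinity. A completion is
  transported along this contraction, from the constants back to the given matrix.

  Let \<open>g f = I\<close>. Then \<open>g\<^sub>\<tau> f\<^sub>\<tau> = I\<close> for all \<open>\<tau>\<close>, and this persists for the constant limit matrices.
  If \<open>f'\<close> has a left inverse \<open>g'\<close> and \<open>f\<close> is close to \<open>f'\<close>, then \<open>f = H f'\<close> for
  \<open>H = I + (f - f') g'\<close>, and \<open>H\<close> is invertible because it is close to \<open>I\<close>; so a completion of \<open>f'\<close> to
  an invertible square matrix yields one of \<open>f\<close> (\<open>completable_perturb\<close>). How close \<open>f\<close> must be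
  depends only on a bound for \<open>g'\<close>, and one bound serves all \<open>g\<^sub>\<tau>\<close>. Hence one passes in finitely
  many steps of equal length from \<open>f\<^sub>0 = f\<close> to some \<open>f\<^sub>\<tau>\<close> that is close to the constant limit
  (\<open>completable_left_invertible\<close>), and the limit has a completion by linear algebra
  (\<open>constant_completion\<close>).

  The inverse of \<open>H\<close> is the adjugate divided by the determinant, so it is enough to invert a scalar
  \<open>u = a + p\<close> with \<open>a \<in> A\<^sub>0\<close> and \<open>p \<in> AP\<^sub>+\<close>, where both \<open>u\<close> and \<open>p\<close> are close to \<open>1\<close>. The geometric
  series inverts \<open>p\<close> in \<open>AP\<^sub>+\<close>, and \<open>u\<^sup>-\<^sup>1 = p\<^sup>-\<^sup>1 - a p\<^sup>-\<^sup>1 u\<^sup>-\<^sup>1\<close>, where the last term is in \<open>A\<^sub>0\<close> because a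
  product of a function in \<open>A\<^sub>0\<close> with a bounded one vanishes at infinity (\<open>AP_part_inverse\<close>). So that
  \<open>p\<close> is at hand in each step, all matrices are carried along together with their almost periodic
  parts, and closeness always refers to both.
\<close>

section \<open>Causal almost periodic functions\<close>

text \<open>
  The span of the exponentials, as a set of functions on the whole plane. The inductive form gives
  induction over a sum of exponentials; \<open>exp_polys_iff\<close> relates it to finite sums with distinct
  exponents.
\<close>

inductive_set exp_polys :: "(complex \<Rightarrow> complex) set" where
  monomial: "0 \<le> t \<Longrightarrow> (\<lambda>s. c * exp (- (s * complex_of_real t))) \<in> exp_polys"
| add: "e \<in> exp_polys \<Longrightarrow> e' \<in> exp_polys \<Longrightarrow> (\<lambda>s. e s + e' s) \<in> exp_polys"

lemma exp_polys_mult_monomial: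
  assumes "e \<in> exp_polys" "0 \<le> t"
  shows "(\<lambda>s. (c * exp (- (s * complex_of_real t))) * e s) \<in> exp_polys"
  using assms(1)
proof induction
  case (monomial t' c')
  have "(\<lambda>s. (c * c') * exp (- (s * complex_of_real (t + t')))) \<in> exp_polys"
    by (rule exp_polys.monomial) (use monomial assms in auto)
  moreover have "(c * c') * exp (- (s * complex_of_real (t + t')))
      = (c * exp (- (s * complex_of_real t))) * (c' * exp (- (s * complex_of_real t')))" for s
    by (simp add: algebra_simps flip: exp_add)
  ultimately show ?case by (simp only:)
next
  case (add e e')
  from exp_polys.add[OF add.IH] show ?case by (simp add: algebra_simps)
qed

lemma exp_polys_mult:
  assumes "e \<in> exp_polys" "e' \<in> exp_polys"
  shows "(\<lambda>s. e s * e' s) \<in> exp_polys"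
  using assms(1)
proof induction
  case (monomial t c)
  then show ?case using exp_polys_mult_monomial[OF assms(2)] by simp
next
  case (add e1 e2)
  from exp_polys.add[OF add.IH] show ?case by (simp add: algebra_simps)
qed

lemma exp_polys_const: "(\<lambda>s. c) \<in> exp_polys"
  using exp_polys.monomial[of 0 c] by simp

lemma exp_polys_iff:
  "e \<in> exp_polys \<longleftrightarrow>
     (\<exists>T c. finite T \<and> T \<subseteq> {0..} \<and> e = (\<lambda>s. \<Sum>t\<in>T. c t * exp (- (s * complex_of_real t))))"
proof
  assume "e \<in> exp_polys"
  then show "\<exists>T c. finite T \<and> T \<subseteq> {0..} \<and> e = (\<lambda>s. \<Sum>t\<in>T. c t * exp (- (s * complex_of_real t)))"
  proof induction
    case (monomial t c)
    then show ?case by (intro exI[of _ "{t}"] exI[of _ "\<lambda>_. c"]) auto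
  next
    case (add e e')
    then obtain T c T' c' where T: "finite T" "T \<subseteq> {0..}" "finite T'" "T' \<subseteq> {0..}"
      and e: "e = (\<lambda>s. \<Sum>t\<in>T. c t * exp (- (s * complex_of_real t)))"
             "e' = (\<lambda>s. \<Sum>t\<in>T'. c' t * exp (- (s * complex_of_real t)))"
      by blast
    define d where "d t = (if t \<in> T then c t else 0) + (if t \<in> T' then c' t else 0)" for t
    have "e s + e' s = (\<Sum>t\<in>T \<union> T'. d t * exp (- (s * complex_of_real t)))" for s
    proof -
      have "e s = (\<Sum>t\<in>T \<union> T'. (if t \<in> T then c t else 0) * exp (- (s * complex_of_real t)))"
        unfolding e using T by (intro sum.mono_neutral_cong_left) auto
      moreover have "e' s = (\<Sum>t\<in>T \<union> T'. (if t \<in> T' then c' t else 0) * exp (- (s * complex_of_real t)))"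
        unfolding e using T by (intro sum.mono_neutral_cong_left) auto
      ultimately show ?thesis
        by (simp add: d_def distrib_right sum.distrib)
    qed
    with T show ?case by (intro exI[of _ "T \<union> T'"] exI[of _ d]) auto
  qed
next
  assume "\<exists>T c. finite T \<and> T \<subseteq> {0..} \<and> e = (\<lambda>s. \<Sum>t\<in>T. c t * exp (- (s * complex_of_real t)))"
  then obtain T c where "finite T" "T \<subseteq> {0..}"
    and e: "e = (\<lambda>s. \<Sum>t\<in>T. c t * exp (- (s * complex_of_real t)))" by blast
  from this(1,2) have "(\<lambda>s. \<Sum>t\<in>T. c t * exp (- (s * complex_of_real t))) \<in> exp_polys"
  proof induction
    case empty
    then show ?case using exp_polys_const[of 0] by simp
  next
    case (insert t T)
    then have "(\<lambda>s. c t * exp (- (s * complex_of_real t)) + (\<Sum>t\<in>T. c t * exp (- (s * complex_of_real t)))) \<in> exp_polys"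
      by (intro exp_polys.add exp_polys.monomial) auto
    with insert show ?case by simp
  qed
  with e show "e \<in> exp_polys" by simp
qed

lemma norm_exp_monomial_le:
  assumes "0 \<le> t" "s \<in> closed_rhp"
  shows "norm (exp (- (s * complex_of_real t))) \<le> 1"
  using assms by (simp add: closed_rhp_def)

lemma convex_closed_rhp: "convex closed_rhp"
  unfolding closed_rhp_def using convex_halfspace_Re_ge[of 0] by simp

lemma open_open_rhp: "open open_rhp"
  unfolding open_rhp_def using open_halfspace_Re_gt[of 0] by simp

lemma closed_closed_rhp: "closed closed_rhp"
  unfolding closed_rhp_def using closed_halfspace_Re_ge[of 0] by simp

lemma open_rhp_subset: "open_rhp \<subseteq> closed_rhp"
  by (auto simp: open_rhp_def closed_rhp_def)

lemma exp_polys_holomorphic: "e \<in> exp_polys \<Longrightarrow> e holomorphic_on UNIV"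
  by (induction rule: exp_polys.induct) (auto intro!: holomorphic_intros)

lemma exp_polys_translate: "e \<in> exp_polys \<Longrightarrow> (\<lambda>s. e (s + z)) \<in> exp_polys"
proof (induction rule: exp_polys.induct)
  case (monomial t c)
  have "(\<lambda>s. (c * exp (- (z * complex_of_real t))) * exp (- (s * complex_of_real t))) \<in> exp_polys"
    by (rule exp_polys.monomial) (fact monomial)
  then show ?case by (simp add: algebra_simps exp_add exp_diff exp_minus divide_simps)
qed (rule exp_polys.add)

lemma exp_polys_bounded:
  "e \<in> exp_polys \<Longrightarrow> \<exists>B. \<forall>s\<in>closed_rhp. norm (e s) \<le> B"
proof (induction rule: exp_polys.induct)
  case (monomial t c)
  then have "\<forall>s\<in>closed_rhp. norm (c * exp (- (s * complex_of_real t))) \<le> norm c * 1"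
    unfolding norm_mult by (intro ballI mult_left_mono norm_exp_monomial_le) auto
  then show ?case by blast
next
  case (add e e')
  then obtain B B' where "\<forall>s\<in>closed_rhp. norm (e s) \<le> B" "\<forall>s\<in>closed_rhp. norm (e' s) \<le> B'"
    by blast
  then have "\<forall>s\<in>closed_rhp. norm (e s + e' s) \<le> B + B'"
    by (blast intro: norm_triangle_mono)
  then show ?case by blast
qed

lemma exp_polys_uniformly_continuous:
  "e \<in> exp_polys \<Longrightarrow> uniformly_continuous_on closed_rhp e"
proof (induction rule: exp_polys.induct)
  case (monomial t c)
  have "norm (c * exp (- (s * complex_of_real t)) - c * exp (- (s' * complex_of_real t)))
      \<le> (norm c * t) * norm (s - s')" if "s \<in> closed_rhp" "s' \<in> closed_rhp" for s s'
  proof (rule field_differentiable_bound[OF convex_closed_rhp _ _ that])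
    fix z assume z: "z \<in> closed_rhp"
    show "((\<lambda>s. c * exp (- (s * complex_of_real t))) has_field_derivative
        (- c * complex_of_real t * exp (- (z * complex_of_real t)))) (at z within closed_rhp)"
      by (auto intro!: derivative_eq_intros)
    have "norm (- c * complex_of_real t * exp (- (z * complex_of_real t))) \<le> (norm c * t) * 1"
      unfolding norm_mult using monomial norm_exp_monomial_le[OF monomial z]
      by (intro mult_mono) auto
    then show "norm (- c * complex_of_real t * exp (- (z * complex_of_real t))) \<le> norm c * t" by simp
  qed
  then have "(norm c * t)-lipschitz_on closed_rhp (\<lambda>s. c * exp (- (s * complex_of_real t)))"
    using monomial by (intro lipschitz_onI) (auto simp: dist_norm)
  then show ?case by (rule lipschitz_on_uniformly_continuous)
qed (rule uniformly_continuous_on_add)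

text \<open>
  A function that can be uniformly approximated by functions with a limit has a limit itself, because
  its image filter is Cauchy.
\<close>

lemma tendsto_uniform_approx:
  fixes p :: "'a \<Rightarrow> complex"
  assumes ntriv: "F \<noteq> bot"
  assumes approx: "\<And>\<epsilon>. 0 < \<epsilon> \<Longrightarrow> \<exists>e c. (e \<longlongrightarrow> c) F \<and> (\<forall>\<^sub>F x in F. norm (p x - e x) \<le> \<epsilon>)"
  shows "\<exists>c. (p \<longlongrightarrow> c) F"
proof -
  have "cauchy_filter (filtermap p F)"
  proof (unfold cauchy_filter_metric_filtermap, intro allI impI)
    fix \<epsilon> :: real assume "0 < \<epsilon>"
    then obtain e c where e: "(e \<longlongrightarrow> c) F" and pe: "\<forall>\<^sub>F x in F. norm (p x - e x) \<le> \<epsilon> / 4"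
      using approx[of "\<epsilon> / 4"] by auto
    from e have ec: "\<forall>\<^sub>F x in F. dist (e x) c < \<epsilon> / 4"
      using \<open>0 < \<epsilon>\<close> by (intro tendstoD) auto
    show "\<exists>P. eventually P F \<and> (\<forall>x y. P x \<and> P y \<longrightarrow> dist (p x) (p y) < \<epsilon>)"
    proof (intro exI conjI allI impI)
      show "\<forall>\<^sub>F x in F. norm (p x - e x) \<le> \<epsilon> / 4 \<and> dist (e x) c < \<epsilon> / 4"
        using pe ec by (rule eventually_conj)
      fix x y assume xy: "(norm (p x - e x) \<le> \<epsilon> / 4 \<and> dist (e x) c < \<epsilon> / 4) \<and>
          (norm (p y - e y) \<le> \<epsilon> / 4 \<and> dist (e y) c < \<epsilon> / 4)"
      have "dist (p x) (p y) \<le> dist (p x) (e x) + dist (e x) c + dist (e y) c + dist (p y) (e y)"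
        by metric
      then show "dist (p x) (p y) < \<epsilon>" using xy \<open>0 < \<epsilon>\<close> by (simp add: dist_norm)
    qed
  qed
  then have "\<exists>c. filtermap p F \<le> nhds c"
    using ntriv complete_UNIV unfolding complete_uniform
    by (auto simp: filtermap_bot_iff elim!: allE[of _ "filtermap p F"])
  then show ?thesis by (simp add: filterlim_def)
qed

text \<open>
  Convergence as \<open>Re s \<rightarrow> \<infinity>\<close>, uniformly in the imaginary part: along this filter the contraction
  of the ring by translations to the right takes place.
\<close>

abbreviation Re_at_top :: "complex filter" where
  "Re_at_top \<equiv> filtercomap Re at_top"

lemma Re_at_top_neq_bot: "Re_at_top \<noteq> bot"
  by (rule filtercomap_neq_bot_surj) (simp, metis Re_complex_of_real surj_def)

lemma eventually_Re_at_top: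
  "eventually P Re_at_top \<longleftrightarrow> (\<exists>\<Lambda>. \<forall>s. \<Lambda> \<le> Re s \<longrightarrow> P s)"
  unfolding eventually_filtercomap eventually_at_top_linorder by blast

lemma eventually_Re_at_top_closed_rhp: "\<forall>\<^sub>F s in Re_at_top. s \<in> closed_rhp"
  unfolding eventually_Re_at_top closed_rhp_def by auto

lemma exp_polys_tendsto: "e \<in> exp_polys \<Longrightarrow> \<exists>c. (e \<longlongrightarrow> c) Re_at_top"
proof (induction rule: exp_polys.induct)
  case (monomial t c)
  show ?case
  proof (cases "t = 0")
    case True
    then show ?thesis by (intro exI[of _ c]) simp
  next
    case False
    have "((\<lambda>x. exp (- (x * t))) \<longlongrightarrow> 0) at_top"
      using False monomial by real_asymp
    then have "((\<lambda>s. norm (exp (- (s * complex_of_real t)))) \<longlongrightarrow> 0) Re_at_top"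
      by (auto intro: filterlim_compose filterlim_filtercomap)
    then have "((\<lambda>s. exp (- (s * complex_of_real t))) \<longlongrightarrow> 0) Re_at_top"
      by (rule tendsto_norm_zero_cancel)
    then have "((\<lambda>s. c * exp (- (s * complex_of_real t))) \<longlongrightarrow> 0) Re_at_top"
      by (rule tendsto_mult_right_zero)
    then show ?thesis by blast
  qed
next
  case (add e e')
  then show ?case by (blast intro: tendsto_add)
qed

text \<open>
  The causal almost periodic functions, with arbitrary values off the closed half plane. Translates and
  pointwise expressions of such functions need not be restricted again; \<open>AP_plus_eq\<close> makes the
  connection with the extensional functions.
\<close>

definition AP :: "(complex \<Rightarrow> complex) set" where
  "AP = {p. \<forall>\<epsilon>>0. \<exists>e\<in>exp_polys. \<forall>s\<in>closed_rhp. norm (p s - e s) \<le> \<epsilon>}"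

lemma APE:
  assumes "p \<in> AP" "0 < \<epsilon>"
  obtains e where "e \<in> exp_polys" "\<And>s. s \<in> closed_rhp \<Longrightarrow> norm (p s - e s) \<le> \<epsilon>"
  using assms unfolding AP_def by blast

lemma AP_uniform_closed:
  assumes "\<And>\<epsilon>. 0 < \<epsilon> \<Longrightarrow> \<exists>q\<in>AP. \<forall>s\<in>closed_rhp. norm (p s - q s) \<le> \<epsilon>"
  shows "p \<in> AP"
  unfolding AP_def
proof (intro CollectI allI impI)
  fix \<epsilon> :: real assume "0 < \<epsilon>"
  then obtain q where q: "q \<in> AP" "\<And>s. s \<in> closed_rhp \<Longrightarrow> norm (p s - q s) \<le> \<epsilon> / 2"
    using assms[of "\<epsilon> / 2"] by auto
  from q(1) obtain e where e: "e \<in> exp_polys" "\<And>s. s \<in> closed_rhp \<Longrightarrow> norm (q s - e s) \<le> \<epsilon> / 2"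
    using APE[of q "\<epsilon> / 2"] \<open>0 < \<epsilon>\<close> by auto
  have "norm (p s - e s) \<le> \<epsilon>" if "s \<in> closed_rhp" for s
    using norm_diff_triangle_le[OF q(2)[OF that] e(2)[OF that]] by simp
  with e(1) show "\<exists>e\<in>exp_polys. \<forall>s\<in>closed_rhp. norm (p s - e s) \<le> \<epsilon>" by blast
qed

lemma AP_cong:
  assumes "p \<in> AP" "\<And>s. s \<in> closed_rhp \<Longrightarrow> q s = p s"
  shows "q \<in> AP"
  using assms unfolding AP_def by simp

lemma exp_polys_AP: "e \<in> exp_polys \<Longrightarrow> e \<in> AP"
  unfolding AP_def by (auto intro!: bexI[of _ e])

lemma AP_const: "(\<lambda>s. c) \<in> AP"
  by (intro exp_polys_AP exp_polys_const)

lemma AP_bounded: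
  assumes "p \<in> AP"
  shows "\<exists>B. \<forall>s\<in>closed_rhp. norm (p s) \<le> B"
proof -
  obtain e where e: "e \<in> exp_polys" "\<And>s. s \<in> closed_rhp \<Longrightarrow> norm (p s - e s) \<le> 1"
    using APE[OF assms, of 1] by auto
  obtain B where "\<forall>s\<in>closed_rhp. norm (e s) \<le> B" using exp_polys_bounded[OF e(1)] by blast
  then have "\<forall>s\<in>closed_rhp. norm (p s) \<le> 1 + B"
    using e(2) norm_triangle_mono[of "p s - e s" 1 "e s" B for s] by (metis diff_add_cancel)
  then show ?thesis by blast
qed

lemma AP_add:
  assumes "p \<in> AP" "q \<in> AP"
  shows "(\<lambda>s. p s + q s) \<in> AP"
  unfolding AP_def
proof (intro CollectI allI impI)
  fix \<epsilon> :: real assume "0 < \<epsilon>"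
  then obtain e e' where e: "e \<in> exp_polys" "\<And>s. s \<in> closed_rhp \<Longrightarrow> norm (p s - e s) \<le> \<epsilon> / 2"
    and e': "e' \<in> exp_polys" "\<And>s. s \<in> closed_rhp \<Longrightarrow> norm (q s - e' s) \<le> \<epsilon> / 2"
    using APE[OF assms(1), of "\<epsilon> / 2"] APE[OF assms(2), of "\<epsilon> / 2"] by (metis half_gt_zero)
  have "norm ((p s + q s) - (e s + e' s)) \<le> \<epsilon>" if "s \<in> closed_rhp" for s
    using norm_triangle_mono[OF e(2)[OF that] e'(2)[OF that]] by (simp add: algebra_simps)
  with exp_polys.add[OF e(1) e'(1)]
  show "\<exists>e\<in>exp_polys. \<forall>s\<in>closed_rhp. norm ((p s + q s) - e s) \<le> \<epsilon>" by (intro bexI) auto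
qed

lemma AP_mult_exp_poly:
  assumes "p \<in> AP" "e \<in> exp_polys"
  shows "(\<lambda>s. p s * e s) \<in> AP"
  unfolding AP_def
proof (intro CollectI allI impI)
  fix \<epsilon> :: real assume "0 < \<epsilon>"
  obtain B where B: "\<forall>s\<in>closed_rhp. norm (e s) \<le> B" using exp_polys_bounded[OF assms(2)] by blast
  define C where "C = max B 0 + 1"
  have C: "0 < C" "\<And>s. s \<in> closed_rhp \<Longrightarrow> norm (e s) \<le> C" using B by (auto simp: C_def)
  obtain e' where e': "e' \<in> exp_polys" "\<And>s. s \<in> closed_rhp \<Longrightarrow> norm (p s - e' s) \<le> \<epsilon> / C"
    using APE[OF assms(1), of "\<epsilon> / C"] \<open>0 < \<epsilon>\<close> C by auto
  have "norm (p s * e s - e' s * e s) \<le> \<epsilon>" if "s \<in> closed_rhp" for s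
  proof -
    have "norm ((p s - e' s) * e s) \<le> (\<epsilon> / C) * C"
      unfolding norm_mult using e'(2)[OF that] C(2)[OF that] C(1) \<open>0 < \<epsilon>\<close> by (intro mult_mono) auto
    then show ?thesis using C(1) by (simp add: algebra_simps)
  qed
  with exp_polys_mult[OF e'(1) assms(2)]
  show "\<exists>e'\<in>exp_polys. \<forall>s\<in>closed_rhp. norm (p s * e s - e' s) \<le> \<epsilon>" by (intro bexI) auto
qed

lemma AP_mult:
  assumes "p \<in> AP" "q \<in> AP"
  shows "(\<lambda>s. p s * q s) \<in> AP"
proof (rule AP_uniform_closed)
  fix \<epsilon> :: real assume "0 < \<epsilon>"
  obtain B where B: "\<forall>s\<in>closed_rhp. norm (p s) \<le> B" using AP_bounded[OF assms(1)] by blast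
  define C where "C = max B 0 + 1"
  have C: "0 < C" "\<And>s. s \<in> closed_rhp \<Longrightarrow> norm (p s) \<le> C" using B by (auto simp: C_def)
  obtain e where e: "e \<in> exp_polys" "\<And>s. s \<in> closed_rhp \<Longrightarrow> norm (q s - e s) \<le> \<epsilon> / C"
    using APE[OF assms(2), of "\<epsilon> / C"] \<open>0 < \<epsilon>\<close> C by auto
  have "norm (p s * q s - p s * e s) \<le> \<epsilon>" if "s \<in> closed_rhp" for s
  proof -
    have "norm (p s * (q s - e s)) \<le> C * (\<epsilon> / C)"
      unfolding norm_mult using e(2)[OF that] C(2)[OF that] C(1) \<open>0 < \<epsilon>\<close> by (intro mult_mono) auto
    then show ?thesis using C(1) by (simp add: algebra_simps)
  qed
  with AP_mult_exp_poly[OF assms(1) e(1)]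
  show "\<exists>q'\<in>AP. \<forall>s\<in>closed_rhp. norm (p s * q s - q' s) \<le> \<epsilon>" by (intro bexI) auto
qed

lemma AP_power: "p \<in> AP \<Longrightarrow> (\<lambda>s. p s ^ m) \<in> AP"
  by (induction m) (auto intro: AP_const AP_mult)

lemma AP_sum: "(\<And>i. i \<in> I \<Longrightarrow> p i \<in> AP) \<Longrightarrow> (\<lambda>s. \<Sum>i\<in>I. p i s) \<in> AP"
  by (induction I rule: infinite_finite_induct) (auto intro: AP_const AP_add)

text \<open>
  The partial sums of the geometric series \<open>\<Sum>(1 - p)\<^sup>i\<close> lie in \<open>AP\<close> and converge to \<open>p\<^sup>-\<^sup>1\<close> uniformly,
  since \<open>1 - p\<close> is bounded by \<open>1/2\<close>.
\<close>

lemma AP_inverse: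
  assumes "p \<in> AP" "\<And>s. s \<in> closed_rhp \<Longrightarrow> norm (p s - 1) \<le> 1/2"
  shows "(\<lambda>s. inverse (p s)) \<in> AP"
proof (rule AP_uniform_closed)
  fix \<epsilon> :: real assume "0 < \<epsilon>"
  obtain m :: nat where m: "(1/2) ^ m < \<epsilon> / 2"
    using real_arch_pow_inv[of "\<epsilon> / 2" "1/2"] \<open>0 < \<epsilon>\<close> by auto
  define q where "q s = (\<Sum>i<m. (1 + (-1) * p s) ^ i)" for s
  have "q \<in> AP"
    unfolding q_def by (intro AP_sum AP_power AP_add AP_mult AP_const assms)
  moreover have "norm (inverse (p s) - q s) \<le> \<epsilon>" if s: "s \<in> closed_rhp" for s
  proof -
    have small: "norm (1 - p s) \<le> 1/2" using assms(2)[OF s] by (simp add: norm_minus_commute)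
    have big: "1/2 \<le> norm (p s)" using small norm_triangle_ineq2[of 1 "1 - p s"] by simp
    then have nz: "p s \<noteq> 0" by auto
    have "q s = (1 - (1 - p s) ^ m) / p s"
      unfolding q_def using nz sum_gp_strict[of "1 - p s" m] by simp
    then have "inverse (p s) - q s = (1 - p s) ^ m / p s"
      using nz by (simp add: field_simps)
    then have "norm (inverse (p s) - q s) = norm (1 - p s) ^ m / norm (p s)"
      by (simp add: norm_divide norm_power)
    also have "\<dots> \<le> (1/2) ^ m / (1/2)"
      using small big by (intro frac_le power_mono) auto
    also have "\<dots> \<le> \<epsilon>" using m by simp
    finally show ?thesis .
  qed
  ultimately show "\<exists>q\<in>AP. \<forall>s\<in>closed_rhp. norm (inverse (p s) - q s) \<le> \<epsilon>" by blast
qed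

lemma closed_rhp_translate: "s \<in> closed_rhp \<Longrightarrow> 0 \<le> \<tau> \<Longrightarrow> s + complex_of_real \<tau> \<in> closed_rhp"
  by (simp add: closed_rhp_def)

lemma open_rhp_translate: "s \<in> open_rhp \<Longrightarrow> 0 \<le> \<tau> \<Longrightarrow> s + complex_of_real \<tau> \<in> open_rhp"
  by (simp add: open_rhp_def)

lemma AP_translate:
  assumes "p \<in> AP" "0 \<le> \<tau>"
  shows "(\<lambda>s. p (s + complex_of_real \<tau>)) \<in> AP"
  unfolding AP_def
proof (intro CollectI allI impI)
  fix \<epsilon> :: real assume "0 < \<epsilon>"
  then obtain e where "e \<in> exp_polys" "\<And>s. s \<in> closed_rhp \<Longrightarrow> norm (p s - e s) \<le> \<epsilon>"
    using APE[OF assms(1)] by blast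
  then show "\<exists>e\<in>exp_polys. \<forall>s\<in>closed_rhp. norm (p (s + complex_of_real \<tau>) - e s) \<le> \<epsilon>"
    using exp_polys_translate closed_rhp_translate[OF _ assms(2)]
    by (intro bexI[of _ "\<lambda>s. e (s + complex_of_real \<tau>)"]) auto
qed

lemma AP_uniformly_continuous:
  assumes "p \<in> AP"
  shows "uniformly_continuous_on closed_rhp p"
  unfolding uniformly_continuous_on_def
proof (intro allI impI)
  fix \<epsilon> :: real assume "0 < \<epsilon>"
  obtain e where e: "e \<in> exp_polys" "\<And>s. s \<in> closed_rhp \<Longrightarrow> norm (p s - e s) \<le> \<epsilon> / 3"
    using APE[OF assms, of "\<epsilon> / 3"] \<open>0 < \<epsilon>\<close> by auto
  obtain \<delta> where \<delta>: "0 < \<delta>" "\<And>s s'. s \<in> closed_rhp \<Longrightarrow> s' \<in> closed_rhp \<Longrightarrow> dist s' s < \<delta> \<Longrightarrow> dist (e s') (e s) < \<epsilon> / 3"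
    using exp_polys_uniformly_continuous[OF e(1)] \<open>0 < \<epsilon>\<close> unfolding uniformly_continuous_on_def
    by (metis divide_pos_pos zero_less_numeral)
  have "dist (p s') (p s) < \<epsilon>" if "s \<in> closed_rhp" "s' \<in> closed_rhp" "dist s' s < \<delta>" for s s'
  proof -
    have "dist (p s') (p s) \<le> dist (p s') (e s') + dist (e s') (e s) + dist (p s) (e s)" by metric
    then show ?thesis using \<delta>(2)[OF that] e(2)[OF that(1)] e(2)[OF that(2)] by (simp add: dist_norm)
  qed
  with \<delta>(1) show "\<exists>\<delta>>0. \<forall>s\<in>closed_rhp. \<forall>s'\<in>closed_rhp. dist s' s < \<delta> \<longrightarrow> dist (p s') (p s) < \<epsilon>"
    by blast
qed

lemma AP_holomorphic:
  assumes "p \<in> AP"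
  shows "p holomorphic_on open_rhp"
proof -
  have "\<forall>m. \<exists>e. e \<in> exp_polys \<and> (\<forall>s\<in>closed_rhp. norm (p s - e s) \<le> 1 / Suc m)"
    using APE[OF assms] by (metis of_nat_0_less_iff zero_less_Suc zero_less_divide_1_iff)
  then obtain e where e: "\<And>m. e m \<in> exp_polys"
    and pe: "\<And>m s. s \<in> closed_rhp \<Longrightarrow> norm (p s - e m s) \<le> 1 / Suc m"
    by metis
  have lim: "uniform_limit closed_rhp e p sequentially"
  proof (rule uniform_limitI)
    fix \<epsilon> :: real assume "0 < \<epsilon>"
    then have "\<forall>\<^sub>F m in sequentially. 1 / Suc m < \<epsilon>" by real_asymp
    then show "\<forall>\<^sub>F m in sequentially. \<forall>s\<in>closed_rhp. dist (e m s) (p s) < \<epsilon>"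
    proof eventually_elim
      case (elim m)
      then show ?case using pe[of _ m] by (force simp: dist_norm norm_minus_commute)
    qed
  qed
  show ?thesis
  proof (rule holomorphic_uniform_sequence[OF open_open_rhp])
    show "e m holomorphic_on open_rhp" for m
      using exp_polys_holomorphic[OF e] holomorphic_on_subset by blast
    fix s assume "s \<in> open_rhp"
    then obtain d where "0 < d" "cball s d \<subseteq> open_rhp"
      using open_open_rhp open_contains_cball by blast
    then show "\<exists>d>0. cball s d \<subseteq> open_rhp \<and> uniform_limit (cball s d) e p sequentially"
      using lim open_rhp_subset by (meson subset_trans uniform_limit_on_subset)
  qed
qed

lemma AP_tendsto:
  assumes "p \<in> AP"
  shows "\<exists>c. (p \<longlongrightarrow> c) Re_at_top"
proof (rule tendsto_uniform_approx[OF Re_at_top_neq_bot])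
  fix \<epsilon> :: real assume "0 < \<epsilon>"
  then obtain e where e: "e \<in> exp_polys" "\<And>s. s \<in> closed_rhp \<Longrightarrow> norm (p s - e s) \<le> \<epsilon>"
    using APE[OF assms] by blast
  have "\<forall>\<^sub>F s in Re_at_top. norm (p s - e s) \<le> \<epsilon>"
    using eventually_Re_at_top_closed_rhp by eventually_elim (rule e(2))
  then show "\<exists>e c. (e \<longlongrightarrow> c) Re_at_top \<and> (\<forall>\<^sub>F s in Re_at_top. norm (p s - e s) \<le> \<epsilon>)"
    using exp_polys_tendsto[OF e(1)] by blast
qed

section \<open>The ideal of functions that vanish at infinity\<close>

abbreviation at_infinity_rhp :: "complex filter" where
  "at_infinity_rhp \<equiv> inf at_infinity (principal closed_rhp)"

text \<open>
  The functions of \<^const>\<open>A0\<close>, but with arbitrary values off the closed half plane.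
\<close>

definition C0 :: "(complex \<Rightarrow> complex) set" where
  "C0 = {a. a holomorphic_on open_rhp \<and> continuous_on closed_rhp a \<and> (a \<longlongrightarrow> 0) at_infinity_rhp}"

lemma eventually_at_infinity_rhp:
  "eventually P at_infinity_rhp \<longleftrightarrow> (\<exists>r. \<forall>s\<in>closed_rhp. r \<le> norm s \<longrightarrow> P s)"
  unfolding eventually_inf_principal eventually_at_infinity by blast

lemma C0_cong:
  assumes "a \<in> C0" "\<And>s. s \<in> closed_rhp \<Longrightarrow> b s = a s"
  shows "b \<in> C0"
proof -
  have "b holomorphic_on open_rhp"
    using assms open_rhp_subset holomorphic_cong[of open_rhp open_rhp b a] by (auto simp: C0_def)
  moreover have "continuous_on closed_rhp b"
    using assms continuous_on_cong[of closed_rhp closed_rhp b a] by (auto simp: C0_def)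
  moreover have "(b \<longlongrightarrow> 0) at_infinity_rhp"
  proof -
    have "\<forall>\<^sub>F s in at_infinity_rhp. b s = a s"
      using assms(2) by (auto simp: eventually_inf_principal)
    then show ?thesis using assms(1) tendsto_cong by (fastforce simp: C0_def)
  qed
  ultimately show ?thesis by (simp add: C0_def)
qed

lemma C0_zero: "(\<lambda>s. 0) \<in> C0"
  by (simp add: C0_def)

lemma C0_add: "a \<in> C0 \<Longrightarrow> b \<in> C0 \<Longrightarrow> (\<lambda>s. a s + b s) \<in> C0"
  unfolding C0_def using tendsto_add_zero by (auto intro!: holomorphic_intros continuous_intros)

lemma C0_mult_bounded:
  assumes "a \<in> C0" "b holomorphic_on open_rhp" "continuous_on closed_rhp b"
    and "\<And>s. s \<in> closed_rhp \<Longrightarrow> norm (b s) \<le> B"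
  shows "(\<lambda>s. a s * b s) \<in> C0"
proof -
  have "((\<lambda>s. a s * b s) \<longlongrightarrow> 0) at_infinity_rhp"
  proof (rule Lim_null_comparison)
    show "\<forall>\<^sub>F s in at_infinity_rhp. norm (a s * b s) \<le> norm (a s) * B"
      using assms(4) by (auto simp: eventually_inf_principal norm_mult mult_left_mono)
    have "((\<lambda>s. norm (a s)) \<longlongrightarrow> 0) at_infinity_rhp"
      using assms(1) by (simp add: C0_def tendsto_norm_zero)
    then show "((\<lambda>s. norm (a s) * B) \<longlongrightarrow> 0) at_infinity_rhp" by (rule tendsto_mult_left_zero)
  qed
  then show ?thesis using assms unfolding C0_def
    by (auto intro!: holomorphic_intros continuous_intros)
qed

lemma C0_bounded:
  assumes "a \<in> C0"
  shows "\<exists>B. \<forall>s\<in>closed_rhp. norm (a s) \<le> B"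
proof -
  have "\<forall>\<^sub>F s in at_infinity_rhp. dist (a s) 0 < 1"
    using assms by (intro tendstoD) (auto simp: C0_def)
  then obtain r where r: "\<And>s. s \<in> closed_rhp \<Longrightarrow> r \<le> norm s \<Longrightarrow> norm (a s) < 1"
    unfolding eventually_at_infinity_rhp by auto
  have "compact (a ` (closed_rhp \<inter> cball 0 r))"
    using assms by (intro compact_continuous_image closed_Int_compact closed_closed_rhp)
      (auto simp: C0_def intro: continuous_on_subset)
  then have "bounded (a ` (closed_rhp \<inter> cball 0 r))" by (rule compact_imp_bounded)
  then obtain B where "\<forall>z\<in>a ` (closed_rhp \<inter> cball 0 r). norm z \<le> B"
    unfolding bounded_iff by blast
  then have B: "norm (a s) \<le> B" if "s \<in> closed_rhp" "norm s \<le> r" for s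
    using that by auto
  have "norm (a s) \<le> max B 1" if "s \<in> closed_rhp" for s
    using r[OF that] B[OF that] by (cases "norm s \<le> r") auto
  then show ?thesis by blast
qed

text \<open>
  Near the origin uniform continuity comes from compactness, far out from the smallness of the values.
  The two regions overlap by an annulus of width \<open>1\<close>, so that two points of distance less than \<open>1\<close> lie
  in a common one.
\<close>

lemma C0_uniformly_continuous:
  assumes "a \<in> C0"
  shows "uniformly_continuous_on closed_rhp a"
  unfolding uniformly_continuous_on_def
proof (intro allI impI)
  fix \<epsilon> :: real assume "0 < \<epsilon>"
  have "\<forall>\<^sub>F s in at_infinity_rhp. dist (a s) 0 < \<epsilon> / 2"
    using assms \<open>0 < \<epsilon>\<close> by (intro tendstoD) (auto simp: C0_def)
  then obtain r where r: "\<And>s. s \<in> closed_rhp \<Longrightarrow> r \<le> norm s \<Longrightarrow> dist (a s) 0 < \<epsilon> / 2"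
    unfolding eventually_at_infinity_rhp by auto
  have "compact (closed_rhp \<inter> cball 0 (r + 1))"
    by (intro closed_Int_compact closed_closed_rhp) auto
  then have "uniformly_continuous_on (closed_rhp \<inter> cball 0 (r + 1)) a"
    using assms by (intro compact_uniformly_continuous) (auto simp: C0_def intro: continuous_on_subset)
  then obtain \<delta> where \<delta>: "0 < \<delta>"
    "\<And>s s'. s \<in> closed_rhp \<inter> cball 0 (r + 1) \<Longrightarrow> s' \<in> closed_rhp \<inter> cball 0 (r + 1) \<Longrightarrow>
        dist s' s < \<delta> \<Longrightarrow> dist (a s') (a s) < \<epsilon>"
    unfolding uniformly_continuous_on_def using \<open>0 < \<epsilon>\<close> by metis
  have "dist (a s') (a s) < \<epsilon>"
    if s: "s \<in> closed_rhp" "s' \<in> closed_rhp" and d: "dist s' s < min \<delta> 1" for s s'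
  proof (cases "norm s \<le> r + 1 \<and> norm s' \<le> r + 1")
    case True
    then show ?thesis using \<delta>(2)[of s s'] s d by auto
  next
    case False
    \<comment> \<open>One of the points is outside the larger disc, so both are outside the smaller one.\<close>
    have "\<bar>norm s - norm s'\<bar> \<le> dist s' s"
      by (metis abs_minus_commute dist_norm norm_triangle_ineq3)
    with False d have "r \<le> norm s" "r \<le> norm s'" by auto
    then have "dist (a s) 0 < \<epsilon> / 2" "dist (a s') 0 < \<epsilon> / 2" using r s by auto
    then show ?thesis using dist_triangle_half_l[of "a s'" 0 \<epsilon> "a s"] by (simp add: dist_commute)
  qed
  with \<delta>(1) show "\<exists>\<delta>>0. \<forall>s\<in>closed_rhp. \<forall>s'\<in>closed_rhp. dist s' s < \<delta> \<longrightarrow> dist (a s') (a s) < \<epsilon>"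
    by (intro exI[of _ "min \<delta> 1"]) auto
qed

lemma C0_translate:
  assumes "a \<in> C0" "0 \<le> \<tau>"
  shows "(\<lambda>s. a (s + complex_of_real \<tau>)) \<in> C0"
proof -
  have "(a \<circ> (\<lambda>s. s + complex_of_real \<tau>)) holomorphic_on open_rhp"
    using assms open_rhp_translate
    by (intro holomorphic_on_compose_gen[of _ _ _ open_rhp]) (auto simp: C0_def intro!: holomorphic_intros)
  moreover have "continuous_on closed_rhp (a \<circ> (\<lambda>s. s + complex_of_real \<tau>))"
    using assms closed_rhp_translate
    by (intro continuous_on_compose) (auto simp: C0_def intro!: continuous_intros elim!: continuous_on_subset)
  moreover have "filterlim (\<lambda>s. s + complex_of_real \<tau>) at_infinity_rhp at_infinity_rhp"
    unfolding filterlim_iff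
  proof (intro allI impI)
    fix P assume "eventually P at_infinity_rhp"
    then obtain r where r: "\<And>s. s \<in> closed_rhp \<Longrightarrow> r \<le> norm s \<Longrightarrow> P s"
      unfolding eventually_at_infinity_rhp by auto
    have "P (s + complex_of_real \<tau>)" if "s \<in> closed_rhp" "r + \<tau> \<le> norm s" for s
      using that assms(2) norm_diff_ineq[of s "complex_of_real \<tau>"] closed_rhp_translate[OF that(1)]
      by (intro r) auto
    then show "\<forall>\<^sub>F s in at_infinity_rhp. P (s + complex_of_real \<tau>)"
      unfolding eventually_at_infinity_rhp by blast
  qed
  ultimately show ?thesis using assms filterlim_compose unfolding C0_def comp_def by blast
qed

lemma C0_tendsto_Re_at_top:
  assumes "a \<in> C0"
  shows "(a \<longlongrightarrow> 0) Re_at_top"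
proof -
  have "Re_at_top \<le> at_infinity_rhp"
  proof (rule filter_leI)
    fix P assume "eventually P at_infinity_rhp"
    then obtain r where r: "\<And>s. s \<in> closed_rhp \<Longrightarrow> r \<le> norm s \<Longrightarrow> P s"
      unfolding eventually_at_infinity_rhp by auto
    have "P s" if "max r 0 \<le> Re s" for s
      using that complex_Re_le_cmod[of s] by (intro r) (auto simp: closed_rhp_def)
    then show "eventually P Re_at_top" unfolding eventually_Re_at_top by blast
  qed
  moreover have "(a \<longlongrightarrow> 0) at_infinity_rhp" using assms by (simp add: C0_def)
  ultimately show ?thesis by (rule tendsto_mono)
qed

section \<open>Functions with an almost periodic part\<close>

text \<open>
  Membership in the sum of \<^const>\<open>C0\<close> and \<^const>\<open>AP\<close>, with the almost periodic summand as a second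
  argument. As a relation it is compatible with the ring operations, so the summand of a composite
  expression (such as a determinant) is the same expression in the summands.
\<close>

definition AP_part :: "(complex \<Rightarrow> complex) \<Rightarrow> (complex \<Rightarrow> complex) \<Rightarrow> bool" where
  "AP_part f p \<longleftrightarrow> p \<in> AP \<and> (\<lambda>s. f s - p s) \<in> C0"

lemma AP_part_self: "p \<in> AP \<Longrightarrow> AP_part p p"
  by (simp add: AP_part_def C0_zero)

lemma AP_part_const: "AP_part (\<lambda>s. c) (\<lambda>s. c)"
  by (intro AP_part_self AP_const)

lemma AP_part_add:
  assumes "AP_part f p" "AP_part g q"
  shows "AP_part (\<lambda>s. f s + g s) (\<lambda>s. p s + q s)"
proof -
  have "(\<lambda>s. (f s - p s) + (g s - q s)) \<in> C0"
    using assms by (intro C0_add) (auto simp: AP_part_def)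
  then show ?thesis using assms by (auto simp: AP_part_def algebra_simps intro: AP_add)
qed

lemma AP_part_holomorphic:
  assumes "AP_part f p"
  shows "f holomorphic_on open_rhp"
proof -
  have "(\<lambda>s. (f s - p s) + p s) holomorphic_on open_rhp"
    using assms AP_holomorphic by (intro holomorphic_on_add) (auto simp: AP_part_def C0_def)
  then show ?thesis by simp
qed

lemma AP_part_uniformly_continuous:
  assumes "AP_part f p"
  shows "uniformly_continuous_on closed_rhp f"
proof -
  have "uniformly_continuous_on closed_rhp (\<lambda>s. (f s - p s) + p s)"
    using assms AP_uniformly_continuous C0_uniformly_continuous
    by (intro uniformly_continuous_on_add) (auto simp: AP_part_def)
  then show ?thesis by simp
qed

lemma AP_part_bounded:
  assumes "AP_part f p"
  shows "\<exists>B. \<forall>s\<in>closed_rhp. norm (f s) \<le> B"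
proof -
  obtain B where B: "\<forall>s\<in>closed_rhp. norm (f s - p s) \<le> B"
    using assms C0_bounded by (auto simp: AP_part_def)
  obtain B' where B': "\<forall>s\<in>closed_rhp. norm (p s) \<le> B'"
    using assms AP_bounded by (auto simp: AP_part_def)
  have "norm (f s) \<le> B + B'" if "s \<in> closed_rhp" for s
    using norm_triangle_mono[of "f s - p s" B "p s" B'] B B' that by simp
  then show ?thesis by blast
qed

lemma AP_part_tendsto:
  assumes "AP_part f p"
  shows "\<exists>c. (f \<longlongrightarrow> c) Re_at_top \<and> (p \<longlongrightarrow> c) Re_at_top"
proof -
  obtain c where c: "(p \<longlongrightarrow> c) Re_at_top"
    using assms AP_tendsto by (auto simp: AP_part_def)
  have "((\<lambda>s. (f s - p s) + p s) \<longlongrightarrow> 0 + c) Re_at_top"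
    using assms C0_tendsto_Re_at_top c by (intro tendsto_add) (auto simp: AP_part_def)
  with c show ?thesis by auto
qed

lemma C0_mult_AP_part:
  assumes "a \<in> C0" "AP_part f p"
  shows "(\<lambda>s. a s * f s) \<in> C0"
  using AP_part_bounded[OF assms(2)]
    C0_mult_bounded[OF assms(1) AP_part_holomorphic[OF assms(2)]
      uniformly_continuous_imp_continuous[OF AP_part_uniformly_continuous[OF assms(2)]]]
  by blast

text \<open>
  \<open>f g - p q = (f - p) g + (g - q) p\<close>, and \<^const>\<open>C0\<close> absorbs products.
\<close>

lemma AP_part_mult:
  assumes "AP_part f p" "AP_part g q"
  shows "AP_part (\<lambda>s. f s * g s) (\<lambda>s. p s * q s)"
proof -
  have "(\<lambda>s. (f s - p s) * g s + (g s - q s) * p s) \<in> C0"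
    using assms by (intro C0_add C0_mult_AP_part[OF _ assms(2)] C0_mult_AP_part[OF _ AP_part_self])
      (auto simp: AP_part_def)
  then show ?thesis using assms by (auto simp: AP_part_def algebra_simps intro: AP_mult)
qed

lemma AP_part_diff:
  assumes "AP_part f p" "AP_part g q"
  shows "AP_part (\<lambda>s. f s - g s) (\<lambda>s. p s - q s)"
  using AP_part_add[OF assms(1) AP_part_mult[OF AP_part_const[of "-1"] assms(2)]] by simp

lemma AP_part_sum:
  "(\<And>i. i \<in> I \<Longrightarrow> AP_part (f i) (p i)) \<Longrightarrow> AP_part (\<lambda>s. \<Sum>i\<in>I. f i s) (\<lambda>s. \<Sum>i\<in>I. p i s)"
  by (induction I rule: infinite_finite_induct) (auto intro: AP_part_const AP_part_add)

lemma AP_part_prod: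
  "(\<And>i. i \<in> I \<Longrightarrow> AP_part (f i) (p i)) \<Longrightarrow> AP_part (\<lambda>s. \<Prod>i\<in>I. f i s) (\<lambda>s. \<Prod>i\<in>I. p i s)"
  by (induction I rule: infinite_finite_induct) (auto intro: AP_part_const AP_part_mult)

lemma AP_part_translate:
  "AP_part f p \<Longrightarrow> 0 \<le> \<tau> \<Longrightarrow>
     AP_part (\<lambda>s. f (s + complex_of_real \<tau>)) (\<lambda>s. p (s + complex_of_real \<tau>))"
  unfolding AP_part_def using AP_translate C0_translate by blast

text \<open>
  \<open>u\<^sup>-\<^sup>1 - p\<^sup>-\<^sup>1 = (u - p) p\<^sup>-\<^sup>1 (- u\<^sup>-\<^sup>1)\<close> is a function in \<^const>\<open>C0\<close> times bounded functions: \<open>u\<close> and \<open>p\<close> have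
  modulus at least \<open>1/2\<close>. Closeness of \<open>p\<close> to \<open>1\<close> puts \<open>p\<^sup>-\<^sup>1\<close> into \<^const>\<open>AP\<close>.
\<close>

lemma AP_part_inverse:
  assumes "AP_part u p"
    and "\<And>s. s \<in> closed_rhp \<Longrightarrow> norm (u s - 1) \<le> 1/2"
    and "\<And>s. s \<in> closed_rhp \<Longrightarrow> norm (p s - 1) \<le> 1/2"
  shows "AP_part (\<lambda>s. inverse (u s)) (\<lambda>s. inverse (p s))"
proof -
  have half: "1/2 \<le> norm z" if "norm (z - 1) \<le> 1/2" for z :: complex
    using that norm_triangle_ineq2[of 1 "1 - z"] by (simp add: norm_minus_commute)
  have u: "1/2 \<le> norm (u s)" if "s \<in> closed_rhp" for s using half assms(2) that by blast
  have p: "1/2 \<le> norm (p s)" if "s \<in> closed_rhp" for s using half assms(3) that by blast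
  have nz: "u s \<noteq> 0" "p s \<noteq> 0" if "s \<in> closed_rhp" for s
    using u[OF that] p[OF that] by auto
  have AP: "(\<lambda>s. inverse (p s)) \<in> AP"
    using assms by (intro AP_inverse) (auto simp: AP_part_def)
  have "(\<lambda>s. - inverse (u s)) holomorphic_on open_rhp"
    using AP_part_holomorphic[OF assms(1)] nz open_rhp_subset by (intro holomorphic_intros) auto
  moreover have "continuous_on closed_rhp (\<lambda>s. - inverse (u s))"
    using uniformly_continuous_imp_continuous[OF AP_part_uniformly_continuous[OF assms(1)]] nz
    by (intro continuous_intros) auto
  moreover have "norm (- inverse (u s)) \<le> 2" if "s \<in> closed_rhp" for s
    using le_imp_inverse_le[OF u[OF that]] by (simp add: norm_inverse)
  ultimately have "(\<lambda>s. ((u s - p s) * inverse (p s)) * (- inverse (u s))) \<in> C0"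
    using assms by (intro C0_mult_bounded[of _ _ 2] C0_mult_AP_part[OF _ AP_part_self[OF AP]])
      (auto simp: AP_part_def)
  then have "(\<lambda>s. inverse (u s) - inverse (p s)) \<in> C0"
    by (rule C0_cong) (use nz in \<open>simp add: field_simps\<close>)
  with AP show ?thesis by (simp add: AP_part_def)
qed

section \<open>Matrices of such functions\<close>

lemma index_mult_mat_sum:
  assumes "A \<in> carrier_mat n m" "B \<in> carrier_mat m k" "i < n" "j < k"
  shows "(A * B) $$ (i, j) = (\<Sum>l<m. A $$ (i, l) * B $$ (l, j))"
  using assms by (auto simp: scalar_prod_def atLeast0LessThan intro!: sum.cong)

text \<open>
  Matrices are functions into complex matrices, so that products, determinants and adjugates are those
  of complex matrices at each point.
\<close>

definition AP_part_mat ::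
  "nat \<Rightarrow> nat \<Rightarrow> (complex \<Rightarrow> complex mat) \<Rightarrow> (complex \<Rightarrow> complex mat) \<Rightarrow> bool" where
  "AP_part_mat n k A P \<longleftrightarrow>
     (\<forall>s. A s \<in> carrier_mat n k \<and> P s \<in> carrier_mat n k) \<and>
     (\<forall>i<n. \<forall>j<k. AP_part (\<lambda>s. A s $$ (i, j)) (\<lambda>s. P s $$ (i, j)))"

lemma AP_part_matD:
  assumes "AP_part_mat n k A P"
  shows "A s \<in> carrier_mat n k" "P s \<in> carrier_mat n k"
    "i < n \<Longrightarrow> j < k \<Longrightarrow> AP_part (\<lambda>s. A s $$ (i, j)) (\<lambda>s. P s $$ (i, j))"
  using assms by (auto simp: AP_part_mat_def)

lemma AP_part_mat_dim:
  assumes "AP_part_mat n k A P"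
  shows "dim_row (A s) = n" "dim_col (A s) = k" "dim_row (P s) = n" "dim_col (P s) = k"
  using AP_part_matD(1,2)[OF assms, of s] by auto

lemma AP_part_mat_const: "C \<in> carrier_mat n k \<Longrightarrow> AP_part_mat n k (\<lambda>s. C) (\<lambda>s. C)"
  by (simp add: AP_part_mat_def AP_part_const)

lemma AP_part_mat_add:
  assumes "AP_part_mat n k A P" "AP_part_mat n k B Q"
  shows "AP_part_mat n k (\<lambda>s. A s + B s) (\<lambda>s. P s + Q s)"
  using AP_part_matD[OF assms(1)] AP_part_matD[OF assms(2)] AP_part_mat_dim[OF assms(2)]
  by (auto simp: AP_part_mat_def intro!: AP_part_add)

lemma AP_part_mat_diff:
  assumes "AP_part_mat n k A P" "AP_part_mat n k B Q"
  shows "AP_part_mat n k (\<lambda>s. A s - B s) (\<lambda>s. P s - Q s)"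
  using AP_part_matD[OF assms(1)] AP_part_matD[OF assms(2)] AP_part_mat_dim[OF assms(2)]
  by (auto simp: AP_part_mat_def intro!: AP_part_diff minus_carrier_mat)

lemma AP_part_mat_mult:
  assumes "AP_part_mat n m A P" "AP_part_mat m k B Q"
  shows "AP_part_mat n k (\<lambda>s. A s * B s) (\<lambda>s. P s * Q s)"
  unfolding AP_part_mat_def
proof (intro conjI allI impI)
  show "A s * B s \<in> carrier_mat n k" "P s * Q s \<in> carrier_mat n k" for s
    using AP_part_matD(1,2)[OF assms(1)] AP_part_matD(1,2)[OF assms(2)]
    by (auto intro: mult_carrier_mat[of _ n m])
  fix i j assume ij: "i < n" "j < k"
  have "AP_part (\<lambda>s. \<Sum>l<m. A s $$ (i, l) * B s $$ (l, j)) (\<lambda>s. \<Sum>l<m. P s $$ (i, l) * Q s $$ (l, j))"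
    using AP_part_matD(3)[OF assms(1)] AP_part_matD(3)[OF assms(2)] ij
    by (intro AP_part_sum AP_part_mult) auto
  then show "AP_part (\<lambda>s. (A s * B s) $$ (i, j)) (\<lambda>s. (P s * Q s) $$ (i, j))"
    using index_mult_mat_sum[OF AP_part_matD(1)[OF assms(1)] AP_part_matD(1)[OF assms(2)] ij]
      index_mult_mat_sum[OF AP_part_matD(2)[OF assms(1)] AP_part_matD(2)[OF assms(2)] ij] by simp
qed

lemma AP_part_mat_translate:
  "AP_part_mat n k A P \<Longrightarrow> 0 \<le> \<tau> \<Longrightarrow>
     AP_part_mat n k (\<lambda>s. A (s + complex_of_real \<tau>)) (\<lambda>s. P (s + complex_of_real \<tau>))"
  unfolding AP_part_mat_def using AP_part_translate by blast

lemma AP_part_det: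
  assumes "AP_part_mat n n A P"
  shows "AP_part (\<lambda>s. det (A s)) (\<lambda>s. det (P s))"
proof -
  have "AP_part
      (\<lambda>s. \<Sum>\<pi> | \<pi> permutes {0..<n}. signof \<pi> * (\<Prod>i = 0..<n. A s $$ (i, \<pi> i)))
      (\<lambda>s. \<Sum>\<pi> | \<pi> permutes {0..<n}. signof \<pi> * (\<Prod>i = 0..<n. P s $$ (i, \<pi> i)))"
    by (intro AP_part_sum AP_part_mult AP_part_const AP_part_prod AP_part_matD(3)[OF assms])
      (auto dest: permutes_in_image)
  then show ?thesis
    using det_def'[OF AP_part_matD(1)[OF assms]] det_def'[OF AP_part_matD(2)[OF assms]] by simp
qed

lemma AP_part_mat_adj_mat:
  assumes "AP_part_mat n n A P"
  shows "AP_part_mat n n (\<lambda>s. adj_mat (A s)) (\<lambda>s. adj_mat (P s))"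
  unfolding AP_part_mat_def
proof (intro conjI allI impI)
  show "adj_mat (A s) \<in> carrier_mat n n" "adj_mat (P s) \<in> carrier_mat n n" for s
    using AP_part_matD(1,2)[OF assms] by (auto intro: adj_mat(1))
  fix i j assume ij: "i < n" "j < n"
  have "AP_part_mat (n - 1) (n - 1) (\<lambda>s. mat_delete (A s) j i) (\<lambda>s. mat_delete (P s) j i)"
    unfolding AP_part_mat_def
    using AP_part_matD(1,2)[OF assms] AP_part_mat_dim[OF assms] ij
    by (auto simp: mat_delete_def intro!: mat_delete_carrier AP_part_matD(3)[OF assms])
  then have "AP_part (\<lambda>s. (-1) ^ (j + i) * det (mat_delete (A s) j i))
      (\<lambda>s. (-1) ^ (j + i) * det (mat_delete (P s) j i))"
    by (intro AP_part_mult AP_part_const AP_part_det)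
  then show "AP_part (\<lambda>s. adj_mat (A s) $$ (i, j)) (\<lambda>s. adj_mat (P s) $$ (i, j))"
    using ij AP_part_mat_dim[OF assms] by (simp add: adj_mat_def cofactor_def)
qed

definition entries_within :: "nat \<Rightarrow> nat \<Rightarrow> real \<Rightarrow> complex mat \<Rightarrow> complex mat \<Rightarrow> bool" where
  "entries_within n k \<epsilon> M N \<longleftrightarrow> (\<forall>i<n. \<forall>j<k. norm (M $$ (i, j) - N $$ (i, j)) \<le> \<epsilon>)"

text \<open>
  Continuity of the determinant at the identity matrix; by contradiction, along a sequence of matrices
  that converges to the identity.
\<close>

lemma det_near_one:
  "\<exists>\<eta>>0. \<forall>M\<in>carrier_mat n n. entries_within n n \<eta> M (1\<^sub>m n) \<longrightarrow> norm (det M - 1) \<le> 1/2"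
proof (rule ccontr)
  assume contra: "\<not> ?thesis"
  have "\<exists>M\<in>carrier_mat n n. entries_within n n (inverse (real (Suc m))) M (1\<^sub>m n)
      \<and> \<not> norm (det M - 1) \<le> 1/2" for m
  proof -
    have "0 < inverse (real (Suc m))" by simp
    with contra show ?thesis by blast
  qed
  then obtain M where M: "\<And>m. M m \<in> carrier_mat n n"
    and near: "\<And>m. entries_within n n (inverse (real (Suc m))) (M m) (1\<^sub>m n)"
    and far: "\<And>m. \<not> norm (det (M m) - 1) \<le> 1/2"
    by metis
  have entry: "(\<lambda>m. M m $$ (i, j)) \<longlonglongrightarrow> 1\<^sub>m n $$ (i, j)" if "i < n" "j < n" for i j
  proof (rule LIM_zero_cancel, rule Lim_null_comparison)
    show "\<forall>\<^sub>F m in sequentially. norm (M m $$ (i, j) - 1\<^sub>m n $$ (i, j)) \<le> inverse (real (Suc m))"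
      using near that by (simp add: entries_within_def)
    show "(\<lambda>m. inverse (real (Suc m))) \<longlonglongrightarrow> 0" by (rule LIMSEQ_inverse_real_of_nat)
  qed
  have "(\<lambda>m. det (M m)) \<longlonglongrightarrow> det (1\<^sub>m n :: complex mat)"
    unfolding det_def'[OF M] det_def'[OF one_carrier_mat]
    by (intro tendsto_sum tendsto_mult tendsto_const tendsto_prod entry) (auto dest: permutes_in_image)
  then have "\<forall>\<^sub>F m in sequentially. dist (det (M m)) 1 < 1/2"
    by (intro tendstoD) auto
  then obtain m where "dist (det (M m)) 1 < 1/2"
    by (auto simp: eventually_sequentially)
  with far[of m] show False by (simp add: dist_norm)
qed

text \<open>
  The inverse is the adjugate divided by the determinant. Both the determinant of \<open>H\<close> and its almost
  periodic part, the determinant of \<open>P\<close>, have to be close to \<open>1\<close> for the division to stay in the ring;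
  this is why \<open>P\<close> is required to be close to the identity as well.
\<close>

lemma AP_part_mat_invertible:
  "\<exists>\<eta>>0. \<forall>H P. AP_part_mat n n H P \<longrightarrow>
     (\<forall>s\<in>closed_rhp. entries_within n n \<eta> (H s) (1\<^sub>m n) \<and> entries_within n n \<eta> (P s) (1\<^sub>m n)) \<longrightarrow>
     (\<exists>K Q. AP_part_mat n n K Q \<and> (\<forall>s\<in>closed_rhp. K s * H s = 1\<^sub>m n))"
proof -
  obtain \<eta> where "0 < \<eta>" and \<eta>:
    "\<forall>M\<in>carrier_mat n n. entries_within n n \<eta> M (1\<^sub>m n) \<longrightarrow> norm (det M - 1) \<le> 1/2"
    using det_near_one by blast
  have "\<exists>K Q. AP_part_mat n n K Q \<and> (\<forall>s\<in>closed_rhp. K s * H s = 1\<^sub>m n)"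
    if HP: "AP_part_mat n n H P"
      and near: "\<forall>s\<in>closed_rhp. entries_within n n \<eta> (H s) (1\<^sub>m n) \<and> entries_within n n \<eta> (P s) (1\<^sub>m n)"
    for H P
  proof -
    have det: "norm (det (H s) - 1) \<le> 1/2" "norm (det (P s) - 1) \<le> 1/2" if "s \<in> closed_rhp" for s
      using near that AP_part_matD(1,2)[OF HP] \<eta> by auto
    define K where "K s = inverse (det (H s)) \<cdot>\<^sub>m adj_mat (H s)" for s
    define Q where "Q s = inverse (det (P s)) \<cdot>\<^sub>m adj_mat (P s)" for s
    note adj = AP_part_mat_adj_mat[OF HP]
    have "AP_part_mat n n K Q"
      unfolding AP_part_mat_def
    proof (intro conjI allI impI)
      show "K s \<in> carrier_mat n n" "Q s \<in> carrier_mat n n" for s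
        using AP_part_matD(1,2)[OF adj] by (auto simp: K_def Q_def)
      fix i j assume ij: "i < n" "j < n"
      have "AP_part (\<lambda>s. inverse (det (H s)) * adj_mat (H s) $$ (i, j))
          (\<lambda>s. inverse (det (P s)) * adj_mat (P s) $$ (i, j))"
        using det by (intro AP_part_mult AP_part_inverse AP_part_det[OF HP] AP_part_matD(3)[OF adj] ij)
      then show "AP_part (\<lambda>s. K s $$ (i, j)) (\<lambda>s. Q s $$ (i, j))"
        using ij AP_part_mat_dim[OF adj] by (simp add: K_def Q_def)
    qed
    moreover have "K s * H s = 1\<^sub>m n" if "s \<in> closed_rhp" for s
    proof -
      have nz: "det (H s) \<noteq> 0" using det(1)[OF that] by auto
      have H: "H s \<in> carrier_mat n n" using AP_part_matD(1)[OF HP] .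
      have "K s * H s = inverse (det (H s)) \<cdot>\<^sub>m (adj_mat (H s) * H s)"
        unfolding K_def by (rule mult_smult_assoc_mat[OF adj_mat(1)[OF H] H])
      also have "\<dots> = 1\<^sub>m n"
        unfolding adj_mat(3)[OF H] using nz by (intro eq_matI) auto
      finally show ?thesis .
    qed
    ultimately show ?thesis by blast
  qed
  with \<open>0 < \<eta>\<close> show ?thesis by blast
qed

text \<open>
  Bounds, moduli of continuity and limits are phrased with filters, so that finitely many entries can
  share one constant.
\<close>

lemma eventually_all_entries:
  fixes n k :: nat
  assumes "\<And>i j. i < n \<Longrightarrow> j < k \<Longrightarrow> eventually (P i j) F"
  shows "\<forall>\<^sub>F x in F. \<forall>i<n. \<forall>j<k. P i j x"
proof -
  have "\<forall>\<^sub>F x in F. \<forall>i\<in>{..<n}. \<forall>j\<in>{..<k}. P i j x"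
    using assms by (intro eventually_ball_finite ballI) auto
  then show ?thesis by eventually_elim auto
qed

lemma AP_part_mat_bounded:
  assumes "AP_part_mat n k A P"
  shows "\<forall>\<^sub>F B in at_top. \<forall>s\<in>closed_rhp. entries_within n k B (A s) (0\<^sub>m n k) \<and> entries_within n k B (P s) (0\<^sub>m n k)"
proof -
  have "\<forall>\<^sub>F B in at_top. \<forall>i<n. \<forall>j<k. \<forall>s\<in>closed_rhp. norm (A s $$ (i, j)) \<le> B \<and> norm (P s $$ (i, j)) \<le> B"
  proof (rule eventually_all_entries)
    fix i j assume "i < n" "j < k"
    note part = AP_part_matD(3)[OF assms this]
    obtain B where B: "\<forall>s\<in>closed_rhp. norm (A s $$ (i, j)) \<le> B"
      using AP_part_bounded[OF part] by blast
    obtain B' where B': "\<forall>s\<in>closed_rhp. norm (P s $$ (i, j)) \<le> B'"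
      using AP_bounded part unfolding AP_part_def by blast
    from B B' show "\<forall>\<^sub>F B in at_top. \<forall>s\<in>closed_rhp. norm (A s $$ (i, j)) \<le> B \<and> norm (P s $$ (i, j)) \<le> B"
      unfolding eventually_at_top_linorder by (intro exI[of _ "max B B'"]) force
  qed
  then show ?thesis by eventually_elim (auto simp: entries_within_def)
qed

lemma AP_part_mat_uniformly_continuous:
  assumes "AP_part_mat n k A P" "0 < \<epsilon>"
  shows "\<forall>\<^sub>F \<delta> in at_right 0. \<forall>s\<in>closed_rhp. \<forall>s'\<in>closed_rhp. dist s' s \<le> \<delta> \<longrightarrow>
      entries_within n k \<epsilon> (A s') (A s) \<and> entries_within n k \<epsilon> (P s') (P s)"
proof -
  have "\<forall>\<^sub>F \<delta> in at_right 0. \<forall>i<n. \<forall>j<k. \<forall>s\<in>closed_rhp. \<forall>s'\<in>closed_rhp. dist s' s \<le> \<delta> \<longrightarrow>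
      norm (A s' $$ (i, j) - A s $$ (i, j)) \<le> \<epsilon> \<and> norm (P s' $$ (i, j) - P s $$ (i, j)) \<le> \<epsilon>"
  proof (rule eventually_all_entries)
    fix i j assume ij: "i < n" "j < k"
    note part = AP_part_matD(3)[OF assms(1) ij]
    obtain \<delta> where \<delta>: "0 < \<delta>" "\<forall>s\<in>closed_rhp. \<forall>s'\<in>closed_rhp. dist s' s < \<delta> \<longrightarrow> dist (A s' $$ (i, j)) (A s $$ (i, j)) < \<epsilon>"
      using AP_part_uniformly_continuous[OF part] assms(2) unfolding uniformly_continuous_on_def by blast
    have "uniformly_continuous_on closed_rhp (\<lambda>s. P s $$ (i, j))"
      using part by (intro AP_uniformly_continuous) (simp add: AP_part_def)
    then obtain \<delta>' where \<delta>': "0 < \<delta>'" "\<forall>s\<in>closed_rhp. \<forall>s'\<in>closed_rhp. dist s' s < \<delta>' \<longrightarrow> dist (P s' $$ (i, j)) (P s $$ (i, j)) < \<epsilon>"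
      using assms(2) unfolding uniformly_continuous_on_def by blast
    have "\<forall>\<^sub>F d in at_right 0. d < min \<delta> \<delta>'"
      using \<delta>(1) \<delta>'(1) by (intro order_tendstoD[OF tendsto_ident_at]) auto
    then show "\<forall>\<^sub>F \<delta> in at_right 0. \<forall>s\<in>closed_rhp. \<forall>s'\<in>closed_rhp. dist s' s \<le> \<delta> \<longrightarrow>
        norm (A s' $$ (i, j) - A s $$ (i, j)) \<le> \<epsilon> \<and> norm (P s' $$ (i, j) - P s $$ (i, j)) \<le> \<epsilon>"
      by eventually_elim (use \<delta>(2) \<delta>'(2) in \<open>fastforce simp: dist_norm\<close>)
  qed
  then show ?thesis by eventually_elim (auto simp: entries_within_def)
qed

lemma AP_part_mat_tendsto:
  assumes "AP_part_mat n k A P"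
  shows "\<exists>C\<in>carrier_mat n k. \<forall>i<n. \<forall>j<k.
     ((\<lambda>s. A s $$ (i, j)) \<longlongrightarrow> C $$ (i, j)) Re_at_top \<and> ((\<lambda>s. P s $$ (i, j)) \<longlongrightarrow> C $$ (i, j)) Re_at_top"
proof -
  have "\<forall>i j. \<exists>c. i < n \<longrightarrow> j < k \<longrightarrow>
      ((\<lambda>s. A s $$ (i, j)) \<longlongrightarrow> c) Re_at_top \<and> ((\<lambda>s. P s $$ (i, j)) \<longlongrightarrow> c) Re_at_top"
    using AP_part_tendsto AP_part_matD(3)[OF assms] by blast
  then obtain c where "\<forall>i j. i < n \<longrightarrow> j < k \<longrightarrow>
      ((\<lambda>s. A s $$ (i, j)) \<longlongrightarrow> c i j) Re_at_top \<and> ((\<lambda>s. P s $$ (i, j)) \<longlongrightarrow> c i j) Re_at_top"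
    by metis
  then show ?thesis by (intro bexI[of _ "mat n k (\<lambda>(i, j). c i j)"]) auto
qed

section \<open>Completion of left invertible matrices\<close>

text \<open>
  Columns are added one at a time, keeping a left inverse. Given \<open>D C = 1\<close> with \<open>k < n\<close>, the matrix
  \<open>E = 1 - C D\<close> is idempotent, satisfies \<open>D E = 0\<close> and \<open>E C = 0\<close>, and is not \<open>0\<close>: otherwise
  \<open>C D = 1\<close>, and comparison of the traces of \<open>C D\<close> and \<open>D C\<close> would give \<open>n = k\<close>. If the entry of
  \<open>E\<close> at \<open>(a, b)\<close> is nonzero, then column \<open>b\<close> of \<open>E\<close> extends \<open>C\<close>, and row \<open>a\<close> of \<open>E\<close> divided by this
  entry extends the left inverse \<open>D\<close>.
\<close>

lemma constant_completion:
  fixes C :: "'a :: field_char_0 mat"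
  assumes "k \<le> n" "C \<in> carrier_mat n k" "D \<in> carrier_mat k n" "D * C = 1\<^sub>m k"
  shows "\<exists>F\<in>carrier_mat n n. \<exists>G\<in>carrier_mat n n. G * F = 1\<^sub>m n \<and>
           (\<forall>i<n. \<forall>j<k. F $$ (i, j) = C $$ (i, j))"
  using assms
proof (induction k arbitrary: C D rule: inc_induct)
  case base
  then show ?case by blast
next
  case (step k)
  note C = \<open>C \<in> carrier_mat n k\<close> and D = \<open>D \<in> carrier_mat k n\<close> and DC = \<open>D * C = 1\<^sub>m k\<close>
  define E where "E = 1\<^sub>m n - C * D"
  have E: "E \<in> carrier_mat n n" unfolding E_def using C D by auto
  have CDC: "C * D * C = C" using C D DC by (simp add: assoc_mult_mat[OF C D C])
  have DCD: "D * (C * D) = D" using C D DC by (simp flip: assoc_mult_mat[OF D C D])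
  have DE: "D * E = 0\<^sub>m k n"
    unfolding E_def using C D DCD
    by (subst mult_minus_distrib_mat[OF D one_carrier_mat]) auto
  have EC: "E * C = 0\<^sub>m n k"
    unfolding E_def using C D CDC
    by (subst minus_mult_distrib_mat[OF one_carrier_mat _ C]) auto
  have EE: "E * E = E"
  proof -
    have "E * E = E * 1\<^sub>m n - E * (C * D)"
      using C D E by (subst (2) E_def, subst mult_minus_distrib_mat[OF E one_carrier_mat]) auto
    also have "E * (C * D) = 0\<^sub>m n n"
      using D EC by (simp flip: assoc_mult_mat[OF E C D])
    finally show ?thesis using E by auto
  qed
  have "\<exists>a<n. \<exists>b<n. E $$ (a, b) \<noteq> 0"
  proof (rule ccontr)
    assume "\<not> ?thesis"
    then have E0: "E $$ (i, i) = 0" if "i < n" for i using that by blast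
    have diag: "(\<Sum>l<k. C $$ (i, l) * D $$ (l, i)) = 1" if "i < n" for i
      using E0[OF that] that C D index_mult_mat_sum[OF C D that that] by (simp add: E_def)
    have "of_nat n = (\<Sum>i<n. \<Sum>l<k. C $$ (i, l) * D $$ (l, i))"
      using diag by simp
    also have "\<dots> = (\<Sum>l<k. \<Sum>i<n. D $$ (l, i) * C $$ (i, l))"
      by (subst sum.swap) (simp add: mult.commute)
    also have "\<dots> = (\<Sum>l<k. (1\<^sub>m k :: 'a mat) $$ (l, l))"
      using index_mult_mat_sum[OF D C] unfolding DC by (intro sum.cong) (auto simp del: index_one_mat)
    also have "\<dots> = of_nat k" by simp
    finally show False using \<open>k < n\<close> by (simp only: of_nat_eq_iff)
  qed
  then obtain a b where ab: "a < n" "b < n" "E $$ (a, b) \<noteq> 0" by blast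
  define C' where "C' = mat n (Suc k) (\<lambda>(i, j). if j < k then C $$ (i, j) else E $$ (i, b))"
  define D' where "D' = mat (Suc k) n (\<lambda>(i, j). if i < k then D $$ (i, j) else E $$ (a, j) / E $$ (a, b))"
  have C': "C' \<in> carrier_mat n (Suc k)" and D': "D' \<in> carrier_mat (Suc k) n"
    by (auto simp: C'_def D'_def)
  have "D' * C' = 1\<^sub>m (Suc k)"
  proof (rule eq_matI)
    fix i j assume "i < dim_row (1\<^sub>m (Suc k) :: 'a mat)" "j < dim_col (1\<^sub>m (Suc k) :: 'a mat)"
    then have ij: "i < Suc k" "j < Suc k" by auto
    have "(D' * C') $$ (i, j) = (\<Sum>l<n. D' $$ (i, l) * C' $$ (l, j))"
      by (rule index_mult_mat_sum[OF D' C' ij])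
    also have "\<dots> = 1\<^sub>m (Suc k) $$ (i, j)"
    proof (cases "i < k")
      case True
      show ?thesis
      proof (cases "j < k")
        case True
        with \<open>i < k\<close> have "(\<Sum>l<n. D' $$ (i, l) * C' $$ (l, j)) = (D * C) $$ (i, j)"
          by (simp add: index_mult_mat_sum[OF D C] D'_def C'_def)
        then show ?thesis using True \<open>i < k\<close> DC by simp
      next
        case False
        with \<open>i < k\<close> ij have "(\<Sum>l<n. D' $$ (i, l) * C' $$ (l, j)) = (D * E) $$ (i, b)"
          using ab by (simp add: index_mult_mat_sum[OF D E] D'_def C'_def)
        then show ?thesis using False \<open>i < k\<close> DE ij ab by simp
      qed
    next
      case False
      show ?thesis
      proof (cases "j < k")
        case True
        with \<open>\<not> i < k\<close> ij have "(\<Sum>l<n. D' $$ (i, l) * C' $$ (l, j)) = (E * C) $$ (a, j) / E $$ (a, b)"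
          using ab by (simp add: index_mult_mat_sum[OF E C] D'_def C'_def sum_divide_distrib)
        then show ?thesis using True \<open>\<not> i < k\<close> EC ij ab by simp
      next
        case False
        with \<open>\<not> i < k\<close> ij have "(\<Sum>l<n. D' $$ (i, l) * C' $$ (l, j)) = (E * E) $$ (a, b) / E $$ (a, b)"
          using ab by (simp add: index_mult_mat_sum[OF E E] D'_def C'_def sum_divide_distrib)
        then show ?thesis using False \<open>\<not> i < k\<close> EE ij ab by simp
      qed
    qed
    finally show "(D' * C') $$ (i, j) = 1\<^sub>m (Suc k) $$ (i, j)" .
  qed (use C' D' in auto)
  from step.IH[OF C' D' this] obtain F G where FG: "F \<in> carrier_mat n n" "G \<in> carrier_mat n n"
    "G * F = 1\<^sub>m n" and F: "\<forall>i<n. \<forall>j<Suc k. F $$ (i, j) = C' $$ (i, j)" by blast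
  moreover have "\<forall>i<n. \<forall>j<k. F $$ (i, j) = C $$ (i, j)"
    using F by (auto simp: C'_def)
  ultimately show ?case by blast
qed

definition completable :: "nat \<Rightarrow> nat \<Rightarrow> (complex \<Rightarrow> complex mat) \<Rightarrow> bool" where
  "completable n k f \<longleftrightarrow>
     k \<le> n \<and> (\<exists>F P G Q. AP_part_mat n n F P \<and> AP_part_mat n n G Q \<and>
        (\<forall>s\<in>closed_rhp. G s * F s = 1\<^sub>m n \<and> (\<forall>i<n. \<forall>j<k. F s $$ (i, j) = f s $$ (i, j))))"

lemma completable_const:
  assumes "k \<le> n" "C \<in> carrier_mat n k" "D \<in> carrier_mat k n" "D * C = 1\<^sub>m k"
  shows "completable n k (\<lambda>s. C)"
proof -
  obtain F G where FG: "F \<in> carrier_mat n n" "G \<in> carrier_mat n n" "G * F = 1\<^sub>m n"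
    "\<forall>i<n. \<forall>j<k. F $$ (i, j) = C $$ (i, j)"
    using constant_completion[OF assms] by blast
  show ?thesis
    unfolding completable_def
    using assms(1) FG by (intro conjI exI[of _ "\<lambda>s. F"] exI[of _ "\<lambda>s. G"]) (auto intro: AP_part_mat_const)
qed

lemma completable_mult:
  assumes "AP_part_mat n n H P" "AP_part_mat n n K Q" "\<And>s. s \<in> closed_rhp \<Longrightarrow> K s * H s = 1\<^sub>m n"
    and f: "\<And>s. f s \<in> carrier_mat n k" and "completable n k f"
  shows "completable n k (\<lambda>s. H s * f s)"
proof -
  obtain F P' G Q' where kn: "k \<le> n" and F: "AP_part_mat n n F P'" and G: "AP_part_mat n n G Q'"
    and GF: "\<And>s. s \<in> closed_rhp \<Longrightarrow> G s * F s = 1\<^sub>m n"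
    and Ff: "\<And>s i j. s \<in> closed_rhp \<Longrightarrow> i < n \<Longrightarrow> j < k \<Longrightarrow> F s $$ (i, j) = f s $$ (i, j)"
    using assms(5) unfolding completable_def by blast
  have GK: "AP_part_mat n n (\<lambda>s. G s * K s) (\<lambda>s. Q' s * Q s)"
    and HF: "AP_part_mat n n (\<lambda>s. H s * F s) (\<lambda>s. P s * P' s)"
    using assms F G by (auto intro: AP_part_mat_mult)
  have c: "H s \<in> carrier_mat n n" "K s \<in> carrier_mat n n" "F s \<in> carrier_mat n n" "G s \<in> carrier_mat n n" for s
    using assms F G by (auto intro: AP_part_matD)
  have "(G s * K s) * (H s * F s) = 1\<^sub>m n" if "s \<in> closed_rhp" for s
  proof -
    have "(G s * K s) * (H s * F s) = G s * ((K s * H s) * F s)"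
      using assoc_mult_mat[OF c(4) c(2) mult_carrier_mat[OF c(1) c(3)]] assoc_mult_mat[OF c(2) c(1) c(3)]
      by simp
    then show ?thesis using assms(3)[OF that] GF[OF that] left_mult_one_mat[OF c(3)] by simp
  qed
  moreover have "(H s * F s) $$ (i, j) = (H s * f s) $$ (i, j)"
    if "s \<in> closed_rhp" "i < n" "j < k" for s i j
  proof -
    have jn: "j < n" using that kn by simp
    show ?thesis
      using Ff that by (simp add: index_mult_mat_sum[OF c(1) c(3) that(2) jn] index_mult_mat_sum[OF c(1) f that(2,3)])
  qed
  ultimately show ?thesis unfolding completable_def using kn HF GK by blast
qed

lemma entries_within_one_plus_mult:
  assumes "f \<in> carrier_mat n k" "f' \<in> carrier_mat n k" "g \<in> carrier_mat k n"
    and "entries_within n k \<epsilon> f f'" "entries_within k n B g (0\<^sub>m k n)" "0 \<le> \<epsilon>"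
  shows "entries_within n n (real k * (\<epsilon> * B)) (1\<^sub>m n + (f - f') * g) (1\<^sub>m n)"
  unfolding entries_within_def
proof (intro allI impI)
  fix i j assume ij: "i < n" "j < n"
  have d: "f - f' \<in> carrier_mat n k" using assms by (simp add: minus_carrier_mat)
  have "(1\<^sub>m n + (f - f') * g) $$ (i, j) - 1\<^sub>m n $$ (i, j) = (\<Sum>l<k. (f - f') $$ (i, l) * g $$ (l, j))"
    using ij assms by (simp del: index_mult_mat(1) add: index_mult_mat_sum[OF d assms(3) ij])
  also have "norm \<dots> \<le> (\<Sum>l<k. \<epsilon> * B)"
    using assms ij by (intro sum_norm_le) (auto simp: entries_within_def norm_mult intro!: mult_mono)
  finally show "norm ((1\<^sub>m n + (f - f') * g) $$ (i, j) - 1\<^sub>m n $$ (i, j)) \<le> real k * (\<epsilon> * B)" by simp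
qed

lemma completable_cong:
  assumes "completable n k f" "\<And>s. s \<in> closed_rhp \<Longrightarrow> f s = f' s"
  shows "completable n k f'"
proof -
  obtain F P G Q where "k \<le> n" "AP_part_mat n n F P" "AP_part_mat n n G Q"
    "\<forall>s\<in>closed_rhp. G s * F s = 1\<^sub>m n \<and> (\<forall>i<n. \<forall>j<k. F s $$ (i, j) = f s $$ (i, j))"
    using assms(1) unfolding completable_def by blast
  then show ?thesis
    unfolding completable_def using assms(2) by (intro conjI exI[of _ F] exI[of _ P] exI[of _ G] exI[of _ Q]) simp_all
qed

text \<open>
  A left invertible matrix \<open>f'\<close> and a matrix \<open>f\<close> close to it differ by an invertible factor:
  \<open>(1 + (f - f') g) f' = f\<close> whenever \<open>g f' = 1\<close>. What counts as close depends only on the dimensions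
  and on a bound \<open>B\<close> for the left inverse \<open>g\<close> and its almost periodic part \<open>q\<close>, so that the same
  \<open>\<epsilon>\<close> works along the whole path of translates.
\<close>

lemma completable_perturb:
  assumes "0 \<le> B"
  obtains \<epsilon> where "0 < \<epsilon>"
    "\<And>f p f' p' g q. AP_part_mat n k f p \<Longrightarrow> AP_part_mat n k f' p' \<Longrightarrow> AP_part_mat k n g q \<Longrightarrow>
     \<forall>s\<in>closed_rhp. g s * f' s = 1\<^sub>m k \<Longrightarrow>
     \<forall>s\<in>closed_rhp. entries_within k n B (g s) (0\<^sub>m k n) \<and> entries_within k n B (q s) (0\<^sub>m k n) \<Longrightarrow>
     \<forall>s\<in>closed_rhp. entries_within n k \<epsilon> (f s) (f' s) \<and> entries_within n k \<epsilon> (p s) (p' s) \<Longrightarrow>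
     completable n k f' \<Longrightarrow> completable n k f"
proof -
  obtain \<eta> where "0 < \<eta>" and \<eta>: "\<forall>H P. AP_part_mat n n H P \<longrightarrow>
     (\<forall>s\<in>closed_rhp. entries_within n n \<eta> (H s) (1\<^sub>m n) \<and> entries_within n n \<eta> (P s) (1\<^sub>m n)) \<longrightarrow>
     (\<exists>K Q. AP_part_mat n n K Q \<and> (\<forall>s\<in>closed_rhp. K s * H s = 1\<^sub>m n))"
    using AP_part_mat_invertible by blast
  \<comment> \<open>The entries of \<open>(f - f') g\<close> are at most \<open>k \<epsilon> B\<close>; the summand \<open>1\<close> avoids division by zero.\<close>
  define \<epsilon> where "\<epsilon> = \<eta> / (real k * B + 1)"
  have pos: "0 < real k * B + 1" using assms by (simp add: add_nonneg_pos)
  have "0 < \<epsilon>" using \<open>0 < \<eta>\<close> pos by (simp add: \<epsilon>_def)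
  have small: "real k * (\<epsilon> * B) \<le> \<eta>"
    using \<open>0 < \<eta>\<close> pos by (simp add: \<epsilon>_def field_simps)
  have "completable n k f"
    if f: "AP_part_mat n k f p" and f': "AP_part_mat n k f' p'" and g: "AP_part_mat k n g q"
      and gf': "\<forall>s\<in>closed_rhp. g s * f' s = 1\<^sub>m k"
      and bound: "\<forall>s\<in>closed_rhp. entries_within k n B (g s) (0\<^sub>m k n) \<and> entries_within k n B (q s) (0\<^sub>m k n)"
      and close: "\<forall>s\<in>closed_rhp. entries_within n k \<epsilon> (f s) (f' s) \<and> entries_within n k \<epsilon> (p s) (p' s)"
      and comp: "completable n k f'"
    for f p f' p' g q
  proof -
    define H where "H s = 1\<^sub>m n + (f s - f' s) * g s" for s
    define P where "P s = 1\<^sub>m n + (p s - p' s) * q s" for s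
    have HP: "AP_part_mat n n H P"
      unfolding H_def P_def
      by (intro AP_part_mat_add AP_part_mat_mult[OF AP_part_mat_diff[OF f f'] g] AP_part_mat_const one_carrier_mat)
    have "entries_within n n \<eta> (H s) (1\<^sub>m n) \<and> entries_within n n \<eta> (P s) (1\<^sub>m n)" if "s \<in> closed_rhp" for s
    proof -
      have "entries_within n n (real k * (\<epsilon> * B)) (H s) (1\<^sub>m n)"
        unfolding H_def using AP_part_matD(1)[OF f] AP_part_matD(1)[OF f'] AP_part_matD(1)[OF g]
          close bound that \<open>0 < \<epsilon>\<close> by (intro entries_within_one_plus_mult) auto
      moreover have "entries_within n n (real k * (\<epsilon> * B)) (P s) (1\<^sub>m n)"
        unfolding P_def using AP_part_matD(2)[OF f] AP_part_matD(2)[OF f'] AP_part_matD(2)[OF g]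
          close bound that \<open>0 < \<epsilon>\<close> by (intro entries_within_one_plus_mult) auto
      ultimately show ?thesis using small unfolding entries_within_def by (meson order_trans)
    qed
    then obtain K Q where KQ: "AP_part_mat n n K Q" "\<forall>s\<in>closed_rhp. K s * H s = 1\<^sub>m n"
      using \<eta> HP by blast
    have "completable n k (\<lambda>s. H s * f' s)"
      using HP KQ comp AP_part_matD(1)[OF f'] by (intro completable_mult[of n H P K Q]) auto
    moreover have "H s * f' s = f s" if "s \<in> closed_rhp" for s
    proof -
      have c: "f s \<in> carrier_mat n k" "f' s \<in> carrier_mat n k" "g s \<in> carrier_mat k n"
        using AP_part_matD(1)[OF f] AP_part_matD(1)[OF f'] AP_part_matD(1)[OF g] by auto
      then have d: "f s - f' s \<in> carrier_mat n k" by (simp add: minus_carrier_mat)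
      have "H s * f' s = f' s + (f s - f' s)"
        unfolding H_def
        using add_mult_distrib_mat[OF one_carrier_mat mult_carrier_mat[OF d c(3)] c(2)]
          assoc_mult_mat[OF d c(3) c(2)] gf' that left_mult_one_mat[OF c(2)] right_mult_one_mat[OF d] by simp
      also have "\<dots> = f s" using c by (intro eq_matI) auto
      finally show ?thesis .
    qed
    ultimately show ?thesis by (rule completable_cong)
  qed
  from \<open>0 < \<epsilon>\<close> this show ?thesis by (rule that)
qed

text \<open>
  The path of translates \<open>tr \<tau> f\<close> joins \<open>f\<close>, at \<open>\<tau> = 0\<close>, to a constant matrix \<open>C\<close>, at
  \<open>\<tau> = \<infinity>\<close>. For \<open>\<tau> \<ge> \<Lambda>\<close> the translate is a small perturbation of \<open>C\<close>; from there one descends to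
  \<open>\<tau> = 0\<close> in steps of length \<open>\<delta>\<close>, each of them a small perturbation.
\<close>

lemma completable_left_invertible:
  assumes "k \<le> n" and f: "AP_part_mat n k f p" and g: "AP_part_mat k n g q"
    and gf: "\<And>s. s \<in> closed_rhp \<Longrightarrow> g s * f s = 1\<^sub>m k"
  shows "completable n k f"
proof -
  obtain C where C: "C \<in> carrier_mat n k" and lim_f: "\<forall>i<n. \<forall>j<k.
      ((\<lambda>s. f s $$ (i, j)) \<longlongrightarrow> C $$ (i, j)) Re_at_top \<and> ((\<lambda>s. p s $$ (i, j)) \<longlongrightarrow> C $$ (i, j)) Re_at_top"
    using AP_part_mat_tendsto[OF f] by blast
  obtain D where D: "D \<in> carrier_mat k n" and lim_g: "\<forall>i<k. \<forall>j<n.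
      ((\<lambda>s. g s $$ (i, j)) \<longlongrightarrow> D $$ (i, j)) Re_at_top \<and> ((\<lambda>s. q s $$ (i, j)) \<longlongrightarrow> D $$ (i, j)) Re_at_top"
    using AP_part_mat_tendsto[OF g] by blast
  have DC: "D * C = 1\<^sub>m k"
  proof (rule eq_matI)
    fix i j assume "i < dim_row (1\<^sub>m k :: complex mat)" "j < dim_col (1\<^sub>m k :: complex mat)"
    then have ij: "i < k" "j < k" by auto
    have "((\<lambda>s. \<Sum>l<n. g s $$ (i, l) * f s $$ (l, j)) \<longlongrightarrow> (\<Sum>l<n. D $$ (i, l) * C $$ (l, j))) Re_at_top"
      using ij lim_f lim_g by (intro tendsto_sum tendsto_mult) auto
    moreover have "\<forall>\<^sub>F s in Re_at_top. (\<Sum>l<n. g s $$ (i, l) * f s $$ (l, j)) = 1\<^sub>m k $$ (i, j)"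
      using eventually_Re_at_top_closed_rhp
    proof eventually_elim
      case (elim s)
      show ?case
        using index_mult_mat_sum[OF AP_part_matD(1)[OF g, of s] AP_part_matD(1)[OF f, of s] ij] gf[OF elim] by simp
    qed
    ultimately have "((\<lambda>s. 1\<^sub>m k $$ (i, j)) \<longlongrightarrow> (\<Sum>l<n. D $$ (i, l) * C $$ (l, j))) Re_at_top"
      by (rule Lim_transform_eventually)
    then have "(\<Sum>l<n. D $$ (i, l) * C $$ (l, j)) = 1\<^sub>m k $$ (i, j)"
      using tendsto_unique[OF Re_at_top_neq_bot _ tendsto_const] by blast
    then show "(D * C) $$ (i, j) = 1\<^sub>m k $$ (i, j)"
      by (simp only: index_mult_mat_sum[OF D C ij])
  qed (use C D in auto)
  note C' = AP_part_mat_const[OF C] and D' = AP_part_mat_const[OF D]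
  \<comment> \<open>One bound for all the left inverses that occur: those of the translates and that of the limit.\<close>
  obtain B where B: "0 \<le> B"
    and gB: "\<forall>s\<in>closed_rhp. entries_within k n B (g s) (0\<^sub>m k n) \<and> entries_within k n B (q s) (0\<^sub>m k n)"
    and DB: "\<forall>s\<in>closed_rhp. entries_within k n B D (0\<^sub>m k n) \<and> entries_within k n B D (0\<^sub>m k n)"
    using eventually_happens'[OF _ eventually_conj[OF eventually_ge_at_top[of 0]
      eventually_conj[OF AP_part_mat_bounded[OF g] AP_part_mat_bounded[OF D']]]] by auto
  obtain \<epsilon> where "0 < \<epsilon>" and perturb:
    "\<And>f p f' p' g q. AP_part_mat n k f p \<Longrightarrow> AP_part_mat n k f' p' \<Longrightarrow> AP_part_mat k n g q \<Longrightarrow>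
     \<forall>s\<in>closed_rhp. g s * f' s = 1\<^sub>m k \<Longrightarrow>
     \<forall>s\<in>closed_rhp. entries_within k n B (g s) (0\<^sub>m k n) \<and> entries_within k n B (q s) (0\<^sub>m k n) \<Longrightarrow>
     \<forall>s\<in>closed_rhp. entries_within n k \<epsilon> (f s) (f' s) \<and> entries_within n k \<epsilon> (p s) (p' s) \<Longrightarrow>
     completable n k f' \<Longrightarrow> completable n k f"
    by (fact completable_perturb[OF B, where n = n and k = k])
  define tr where "tr \<tau> A = (\<lambda>s. A (s + complex_of_real \<tau>))" for \<tau> and A :: "complex \<Rightarrow> complex mat"
  have trf: "AP_part_mat n k (tr \<tau> f) (tr \<tau> p)" and trg: "AP_part_mat k n (tr \<tau> g) (tr \<tau> q)"
    if "0 \<le> \<tau>" for \<tau>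
    unfolding tr_def using that f g by (auto intro: AP_part_mat_translate)
  have "\<forall>\<^sub>F s in Re_at_top. \<forall>i<n. \<forall>j<k. dist (f s $$ (i, j)) (C $$ (i, j)) < \<epsilon> \<and> dist (p s $$ (i, j)) (C $$ (i, j)) < \<epsilon>"
    using \<open>0 < \<epsilon>\<close> lim_f by (intro eventually_all_entries eventually_conj tendstoD) auto
  then have "\<forall>\<^sub>F s in Re_at_top. entries_within n k \<epsilon> (f s) C \<and> entries_within n k \<epsilon> (p s) C"
    by eventually_elim (auto simp: entries_within_def dist_norm less_imp_le)
  then obtain \<Lambda> where \<Lambda>: "\<And>s. \<Lambda> \<le> Re s \<Longrightarrow> entries_within n k \<epsilon> (f s) C \<and> entries_within n k \<epsilon> (p s) C"
    unfolding eventually_Re_at_top by blast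
  \<comment> \<open>The limit \<open>C\<close> is completable by linear algebra, hence so are all translates close to it.\<close>
  have far: "completable n k (tr \<tau> f)" if "0 \<le> \<tau>" "\<Lambda> \<le> \<tau>" for \<tau>
  proof (rule perturb[OF trf[OF that(1)] C' D'])
    show "\<forall>s\<in>closed_rhp. entries_within n k \<epsilon> (tr \<tau> f s) C \<and> entries_within n k \<epsilon> (tr \<tau> p s) C"
      using that by (auto simp: tr_def closed_rhp_def intro!: \<Lambda>[THEN conjunct1] \<Lambda>[THEN conjunct2])
    show "completable n k (\<lambda>s. C)"
      by (rule completable_const[OF \<open>k \<le> n\<close> C D DC])
  qed (use DB DC in auto)
  obtain \<delta> where "0 < \<delta>" and \<delta>: "\<forall>s\<in>closed_rhp. \<forall>s'\<in>closed_rhp. dist s' s \<le> \<delta> \<longrightarrow>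
      entries_within n k \<epsilon> (f s') (f s) \<and> entries_within n k \<epsilon> (p s') (p s)"
    using eventually_happens'[OF trivial_limit_at_right_real eventually_conj[OF eventually_at_right_less
      AP_part_mat_uniformly_continuous[OF f \<open>0 < \<epsilon>\<close>]]] by auto
  have step_down: "completable n k (tr \<tau> f)" if "0 \<le> \<tau>" "completable n k (tr (\<tau> + \<delta>) f)" for \<tau>
  proof (rule perturb[OF trf trf trg _ _ _ that(2)])
    show "\<forall>s\<in>closed_rhp. tr (\<tau> + \<delta>) g s * tr (\<tau> + \<delta>) f s = 1\<^sub>m k"
      using gf closed_rhp_translate that \<open>0 < \<delta>\<close> by (simp add: tr_def del: of_real_add)
    show "\<forall>s\<in>closed_rhp. entries_within k n B (tr (\<tau> + \<delta>) g s) (0\<^sub>m k n) \<and>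
        entries_within k n B (tr (\<tau> + \<delta>) q s) (0\<^sub>m k n)"
      using gB closed_rhp_translate that \<open>0 < \<delta>\<close> by (simp add: tr_def del: of_real_add)
    show "\<forall>s\<in>closed_rhp. entries_within n k \<epsilon> (tr \<tau> f s) (tr (\<tau> + \<delta>) f s) \<and>
        entries_within n k \<epsilon> (tr \<tau> p s) (tr (\<tau> + \<delta>) p s)"
      unfolding tr_def
    proof
      fix s assume s: "s \<in> closed_rhp"
      have "s + complex_of_real (\<tau> + \<delta>) \<in> closed_rhp" "s + complex_of_real \<tau> \<in> closed_rhp"
        using s that \<open>0 < \<delta>\<close> by (auto intro!: closed_rhp_translate simp del: of_real_add)
      moreover have "dist (s + complex_of_real \<tau>) (s + complex_of_real (\<tau> + \<delta>)) \<le> \<delta>"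
        using \<open>0 < \<delta>\<close> by (simp add: dist_norm)
      ultimately show "entries_within n k \<epsilon> (f (s + complex_of_real \<tau>)) (f (s + complex_of_real (\<tau> + \<delta>))) \<and>
        entries_within n k \<epsilon> (p (s + complex_of_real \<tau>)) (p (s + complex_of_real (\<tau> + \<delta>)))"
        using \<delta> by blast
    qed
  qed (use that \<open>0 < \<delta>\<close> in auto)
  obtain m :: nat where m: "\<Lambda> \<le> real m * \<delta>"
    using reals_Archimedean3[OF \<open>0 < \<delta>\<close>] less_imp_le by blast
  have "completable n k (tr (real l * \<delta>) f)" if "l \<le> m" for l
    using that
  proof (induction l rule: inc_induct)
    case base
    show ?case using m \<open>0 < \<delta>\<close> by (intro far) auto
  next
    case (step l)
    have "completable n k (tr (real l * \<delta> + \<delta>) f)"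
      using step.IH by (simp add: algebra_simps)
    then show ?case by (rule step_down[rotated]) (use \<open>0 < \<delta>\<close> in simp)
  qed
  from this[of 0] show ?thesis by (simp add: tr_def)
qed

section \<open>The ring of sums\<close>

lemma causal_exp_span_eq: "causal_exp_span = (\<lambda>e. restrict e closed_rhp) ` exp_polys"
proof (intro equalityI subsetI)
  fix f assume "f \<in> causal_exp_span"
  then obtain T c where "finite T" "T \<subseteq> {0..}"
    and f: "f = restrict (\<lambda>s. \<Sum>t\<in>T. c t * exp (- (s * complex_of_real t))) closed_rhp"
    unfolding causal_exp_span_def by blast
  then have "(\<lambda>s. \<Sum>t\<in>T. c t * exp (- (s * complex_of_real t))) \<in> exp_polys"
    unfolding exp_polys_iff by blast
  with f show "f \<in> (\<lambda>e. restrict e closed_rhp) ` exp_polys" by (rule image_eqI)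
next
  fix f assume "f \<in> (\<lambda>e. restrict e closed_rhp) ` exp_polys"
  then obtain e where f: "f = restrict e closed_rhp" and "e \<in> exp_polys" by (rule imageE)
  then obtain T c where "finite T" "T \<subseteq> {0..}"
    and "e = (\<lambda>s. \<Sum>t\<in>T. c t * exp (- (s * complex_of_real t)))"
    unfolding exp_polys_iff by (elim exE conjE)
  with f show "f \<in> causal_exp_span"
    unfolding causal_exp_span_def by (intro CollectI exI[of _ T] exI[of _ c] conjI) (simp only:)
qed

lemma closed_rhp_nonempty: "closed_rhp \<noteq> {}"
  by (auto simp: closed_rhp_def intro!: exI[of _ 0])

text \<open>
  Convergence for the distance of \<^const>\<open>funspace\<close> is uniform convergence on the closed half plane,
  because sums of exponentials are bounded there and so are their uniform limits.
\<close>

lemma AP_plus_eq: "AP_plus = extensional closed_rhp \<inter> AP"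
proof -
  let ?F = "Met_TC.fspace closed_rhp :: (complex \<Rightarrow> complex) set"
  let ?d = "Met_TC.fdist closed_rhp :: (complex \<Rightarrow> complex) \<Rightarrow> _"
  have mem: "f \<in> ?F \<longleftrightarrow> f \<in> extensional closed_rhp \<and> (\<exists>B. \<forall>s\<in>closed_rhp. norm (f s) \<le> B)" for f
    by (auto simp: Met_TC.fspace_def bounded_iff)
  have dist_le: "dist (f s) (g s) \<le> ?d f g" if "f \<in> ?F" "g \<in> ?F" "s \<in> closed_rhp" for f g s
    using that closed_rhp_nonempty Met_TC.bdd_above_dist[OF that(1,2) closed_rhp_nonempty]
    by (auto simp: Met_TC.fdist_def intro!: cSUP_upper)
  have le_dist: "?d f g \<le> \<epsilon>"
    if "f \<in> ?F" "g \<in> ?F" "\<And>s. s \<in> closed_rhp \<Longrightarrow> dist (f s) (g s) \<le> \<epsilon>" for f g \<epsilon>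
    using that closed_rhp_nonempty by (auto simp: Met_TC.fdist_def intro!: cSUP_least)
  have exp_mem: "restrict e closed_rhp \<in> ?F" if "e \<in> exp_polys" for e
    using exp_polys_bounded[OF that] by (auto simp: mem)
  have closure: "AP_plus = {f \<in> ?F. \<forall>r>0. \<exists>e\<in>exp_polys. ?d f (restrict e closed_rhp) < r}"
    unfolding AP_plus_def mtopology_of_def causal_exp_span_eq
    using exp_mem
    by (auto simp: Metric_space.metric_closure_of[OF Met_TC.Metric_space_funspace]
        Metric_space.in_mball[OF Met_TC.Metric_space_funspace])
  show ?thesis
  proof (intro equalityI subsetI)
    fix f assume f: "f \<in> AP_plus"
    then have "f \<in> ?F" by (simp add: closure)
    have "\<exists>e\<in>exp_polys. \<forall>s\<in>closed_rhp. norm (f s - e s) \<le> \<epsilon>" if "0 < \<epsilon>" for \<epsilon>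
    proof -
      obtain e where e: "e \<in> exp_polys" "?d f (restrict e closed_rhp) < \<epsilon>"
        using f \<open>0 < \<epsilon>\<close> unfolding closure by blast
      have "norm (f s - e s) \<le> \<epsilon>" if "s \<in> closed_rhp" for s
        using dist_le[OF \<open>f \<in> ?F\<close> exp_mem[OF e(1)] that] e(2) that by (simp add: dist_norm)
      with e(1) show ?thesis by blast
    qed
    then show "f \<in> extensional closed_rhp \<inter> AP"
      using \<open>f \<in> ?F\<close> by (simp add: mem AP_def)
  next
    fix f assume f: "f \<in> extensional closed_rhp \<inter> AP"
    then have "f \<in> ?F" using AP_bounded by (simp add: mem)
    have "\<exists>e\<in>exp_polys. ?d f (restrict e closed_rhp) < r" if "0 < r" for r
    proof -
      obtain e where e: "e \<in> exp_polys" "\<And>s. s \<in> closed_rhp \<Longrightarrow> norm (f s - e s) \<le> r / 2"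
        using f APE[of f "r / 2"] \<open>0 < r\<close> by auto
      have "?d f (restrict e closed_rhp) \<le> r / 2"
        using e by (intro le_dist \<open>f \<in> ?F\<close> exp_mem) (auto simp: dist_norm)
      with e(1) \<open>0 < r\<close> show ?thesis by (intro bexI[of _ e]) auto
    qed
    with \<open>f \<in> ?F\<close> show "f \<in> AP_plus" by (simp add: closure)
  qed
qed

lemma A0_eq: "A0 = extensional closed_rhp \<inter> C0"
  by (auto simp: A0_def C0_def)

lemma A0_AP_plus_iff:
  "f \<in> A0_AP_plus \<longleftrightarrow> f \<in> extensional closed_rhp \<and> (\<exists>p. AP_part f p)"
proof
  assume "f \<in> A0_AP_plus"
  then obtain a p where f: "f = restrict (\<lambda>s. a s + p s) closed_rhp" and a: "a \<in> C0" and p: "p \<in> AP"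
    by (auto simp: A0_AP_plus_def A0_eq AP_plus_eq)
  have "(\<lambda>s. f s - p s) \<in> C0" by (rule C0_cong[OF a]) (simp add: f)
  with p f show "f \<in> extensional closed_rhp \<and> (\<exists>p. AP_part f p)" by (auto simp: AP_part_def)
next
  assume "f \<in> extensional closed_rhp \<and> (\<exists>p. AP_part f p)"
  then obtain p where f: "f \<in> extensional closed_rhp" and p: "p \<in> AP" and a: "(\<lambda>s. f s - p s) \<in> C0"
    by (auto simp: AP_part_def)
  have "restrict (\<lambda>s. f s - p s) closed_rhp \<in> A0"
    unfolding A0_eq using C0_cong[OF a] by simp
  moreover have "restrict p closed_rhp \<in> AP_plus"
    unfolding AP_plus_eq using AP_cong[OF p] by simp
  moreover have "f = restrict (\<lambda>s. restrict (\<lambda>s. f s - p s) closed_rhp s + restrict p closed_rhp s) closed_rhp"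
    using f by (auto simp: extensional_def fun_eq_iff)
  ultimately show "f \<in> A0_AP_plus" unfolding A0_AP_plus_def by blast
qed

lemma AP_part_cong:
  "AP_part f p \<Longrightarrow> (\<And>s. s \<in> closed_rhp \<Longrightarrow> g s = f s) \<Longrightarrow> AP_part g p"
  unfolding AP_part_def by (auto elim: C0_cong)

lemma restrict_A0_AP_plus: "AP_part f p \<Longrightarrow> restrict f closed_rhp \<in> A0_AP_plus"
  unfolding A0_AP_plus_iff using AP_part_cong[of f p "restrict f closed_rhp"] by auto

lemma A0_AP_plus_const: "restrict (\<lambda>s. c) closed_rhp \<in> A0_AP_plus"
  by (rule restrict_A0_AP_plus[OF AP_part_const])

lemma A0_AP_plus_add:
  "f \<in> A0_AP_plus \<Longrightarrow> g \<in> A0_AP_plus \<Longrightarrow> restrict (\<lambda>s. f s + g s) closed_rhp \<in> A0_AP_plus"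
  using AP_part_add by (blast dest: A0_AP_plus_iff[THEN iffD1] intro: restrict_A0_AP_plus)

lemma A0_AP_plus_mult:
  "f \<in> A0_AP_plus \<Longrightarrow> g \<in> A0_AP_plus \<Longrightarrow> restrict (\<lambda>s. f s * g s) closed_rhp \<in> A0_AP_plus"
  using AP_part_mult by (blast dest: A0_AP_plus_iff[THEN iffD1] intro: restrict_A0_AP_plus)

lemma A0_AP_plus_extensional: "f \<in> A0_AP_plus \<Longrightarrow> f \<in> extensional closed_rhp"
  by (simp add: A0_AP_plus_iff)

lemma A0_AP_plus_ring_simps:
  "carrier A0_AP_plus_ring = A0_AP_plus"
  "f \<otimes>\<^bsub>A0_AP_plus_ring\<^esub> g = restrict (\<lambda>s. f s * g s) closed_rhp"
  "f \<oplus>\<^bsub>A0_AP_plus_ring\<^esub> g = restrict (\<lambda>s. f s + g s) closed_rhp"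
  "\<one>\<^bsub>A0_AP_plus_ring\<^esub> = restrict (\<lambda>s. 1) closed_rhp"
  "\<zero>\<^bsub>A0_AP_plus_ring\<^esub> = restrict (\<lambda>s. 0) closed_rhp"
  by (simp_all add: A0_AP_plus_ring_def)

lemma ring_A0_AP_plus: "ring A0_AP_plus_ring"
proof (rule ringI)
  show "abelian_group A0_AP_plus_ring"
  proof (rule abelian_groupI, unfold A0_AP_plus_ring_simps)
    fix f assume f: "f \<in> A0_AP_plus"
    show "\<exists>g\<in>A0_AP_plus. restrict (\<lambda>s. g s + f s) closed_rhp = restrict (\<lambda>s. 0) closed_rhp"
      using A0_AP_plus_mult[OF A0_AP_plus_const[of "-1"] f] by (rule bexI[rotated]) auto
  qed (auto simp: A0_AP_plus_add A0_AP_plus_const add_ac dest!: A0_AP_plus_extensional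
      intro!: extensionalityI[of _ closed_rhp])
  show "monoid A0_AP_plus_ring"
    by (rule monoidI, unfold A0_AP_plus_ring_simps)
      (auto simp: A0_AP_plus_mult A0_AP_plus_const mult_ac dest!: A0_AP_plus_extensional
      intro!: extensionalityI[of _ closed_rhp])
qed (auto simp: A0_AP_plus_ring_simps algebra_simps)

lemma finsum_A0_AP_plus:
  assumes "finite I" "\<And>i. i \<in> I \<Longrightarrow> f i \<in> A0_AP_plus"
  shows "finsum A0_AP_plus_ring f I = restrict (\<lambda>s. \<Sum>i\<in>I. f i s) closed_rhp"
proof -
  interpret ring A0_AP_plus_ring by (rule ring_A0_AP_plus)
  show ?thesis using assms
  proof (induction I rule: finite_induct)
    case empty
    then show ?case by (simp add: A0_AP_plus_ring_simps)
  next
    case (insert i I)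
    then have "finsum A0_AP_plus_ring f (insert i I)
        = f i \<oplus>\<^bsub>A0_AP_plus_ring\<^esub> finsum A0_AP_plus_ring f I"
      by (intro finsum_insert) (auto simp: A0_AP_plus_ring_simps)
    with insert show ?case by (auto simp: A0_AP_plus_ring_simps)
  qed
qed

text \<open>
  Passage between matrices of functions, over which the ring is defined, and matrix-valued functions,
  for which the completion has been constructed.
\<close>

definition eval_mat :: "(complex \<Rightarrow> complex) mat \<Rightarrow> complex \<Rightarrow> complex mat" where
  "eval_mat A s = map_mat (\<lambda>f. f s) A"

definition restrict_mat :: "nat \<Rightarrow> nat \<Rightarrow> (complex \<Rightarrow> complex mat) \<Rightarrow> (complex \<Rightarrow> complex) mat" where
  "restrict_mat n k A = mat n k (\<lambda>(i, j). restrict (\<lambda>s. A s $$ (i, j)) closed_rhp)"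

lemma matrices_over_A0_AP_plus_iff:
  "A \<in> matrices_over A0_AP_plus_ring n k \<longleftrightarrow>
     A \<in> carrier_mat n k \<and> (\<forall>i<n. \<forall>j<k. A $$ (i, j) \<in> A0_AP_plus)"
proof
  assume A: "A \<in> matrices_over A0_AP_plus_ring n k"
  then have "A $$ (i, j) \<in> A0_AP_plus" if "i < n" "j < k" for i j
    using elements_matI[OF _ that refl, of A] by (auto simp: matrices_over_def A0_AP_plus_ring_simps)
  with A show "A \<in> carrier_mat n k \<and> (\<forall>i<n. \<forall>j<k. A $$ (i, j) \<in> A0_AP_plus)"
    by (simp add: matrices_over_def)
next
  assume "A \<in> carrier_mat n k \<and> (\<forall>i<n. \<forall>j<k. A $$ (i, j) \<in> A0_AP_plus)"
  then show "A \<in> matrices_over A0_AP_plus_ring n k"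
    by (auto simp: matrices_over_def A0_AP_plus_ring_simps dest!: elements_matD)
qed

lemma eval_mat_AP_part:
  assumes "A \<in> matrices_over A0_AP_plus_ring n k"
  shows "\<exists>P. AP_part_mat n k (eval_mat A) P"
proof -
  have A: "A \<in> carrier_mat n k" and mem: "\<And>i j. i < n \<Longrightarrow> j < k \<Longrightarrow> A $$ (i, j) \<in> A0_AP_plus"
    using assms by (auto simp: matrices_over_A0_AP_plus_iff)
  have "\<forall>i j. \<exists>p. i < n \<longrightarrow> j < k \<longrightarrow> AP_part (A $$ (i, j)) p"
    using mem by (auto simp: A0_AP_plus_iff)
  then obtain p where "\<forall>i j. i < n \<longrightarrow> j < k \<longrightarrow> AP_part (A $$ (i, j)) (p i j)"
    by metis
  with A show ?thesis
    by (intro exI[of _ "\<lambda>s. mat n k (\<lambda>(i, j). p i j s)"]) (auto simp: AP_part_mat_def eval_mat_def)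
qed

lemma restrict_mat_matrices_over:
  "AP_part_mat n k A P \<Longrightarrow> restrict_mat n k A \<in> matrices_over A0_AP_plus_ring n k"
  by (auto simp: matrices_over_A0_AP_plus_iff restrict_mat_def AP_part_mat_def
      intro!: restrict_A0_AP_plus)

lemma eval_restrict_mat:
  "AP_part_mat n k A P \<Longrightarrow> s \<in> closed_rhp \<Longrightarrow> eval_mat (restrict_mat n k A) s = A s"
  by (intro eq_matI) (auto simp: eval_mat_def restrict_mat_def AP_part_mat_dim)

lemma mat_mult_over_eq_one_iff:
  assumes A: "A \<in> matrices_over A0_AP_plus_ring n m" and B: "B \<in> matrices_over A0_AP_plus_ring m n"
  shows "mat_mult_over A0_AP_plus_ring A B = mat_one_over A0_AP_plus_ring n \<longleftrightarrow>
     (\<forall>s\<in>closed_rhp. eval_mat A s * eval_mat B s = 1\<^sub>m n)"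
proof -
  have cA: "A \<in> carrier_mat n m" and cB: "B \<in> carrier_mat m n"
    and mA: "\<And>i j. i < n \<Longrightarrow> j < m \<Longrightarrow> A $$ (i, j) \<in> A0_AP_plus"
    and mB: "\<And>i j. i < m \<Longrightarrow> j < n \<Longrightarrow> B $$ (i, j) \<in> A0_AP_plus"
    using A B by (auto simp: matrices_over_A0_AP_plus_iff)
  have ec: "eval_mat A s \<in> carrier_mat n m" "eval_mat B s \<in> carrier_mat m n" for s
    using cA cB by (auto simp: eval_mat_def)
  have entry: "mat_mult_over A0_AP_plus_ring A B $$ (i, j) =
      restrict (\<lambda>s. (eval_mat A s * eval_mat B s) $$ (i, j)) closed_rhp" if "i < n" "j < n" for i j
  proof -
    have "mat_mult_over A0_AP_plus_ring A B $$ (i, j) =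
        finsum A0_AP_plus_ring (\<lambda>l. restrict (\<lambda>s. (A $$ (i, l)) s * (B $$ (l, j)) s) closed_rhp) {0..<m}"
      using cA cB that by (simp add: mat_mult_over_def A0_AP_plus_ring_simps)
    also have "\<dots> = restrict (\<lambda>s. \<Sum>l<m. restrict (\<lambda>s. (A $$ (i, l)) s * (B $$ (l, j)) s) closed_rhp s) closed_rhp"
      using mA mB that by (subst finsum_A0_AP_plus) (auto intro!: A0_AP_plus_mult simp: atLeast0LessThan)
    also have "\<dots> = restrict (\<lambda>s. (eval_mat A s * eval_mat B s) $$ (i, j)) closed_rhp"
    proof (rule restrict_ext)
      fix s assume "s \<in> closed_rhp"
      then show "(\<Sum>l<m. restrict (\<lambda>s. (A $$ (i, l)) s * (B $$ (l, j)) s) closed_rhp s) =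
          (eval_mat A s * eval_mat B s) $$ (i, j)"
        unfolding index_mult_mat_sum[OF ec(1) ec(2) that]
        using cA cB that by (auto simp: eval_mat_def intro!: sum.cong)
    qed
    finally show ?thesis .
  qed
  have one: "mat_one_over A0_AP_plus_ring n $$ (i, j) = restrict (\<lambda>s. 1\<^sub>m n $$ (i, j)) closed_rhp"
    if "i < n" "j < n" for i j
    using that by (simp add: mat_one_over_def A0_AP_plus_ring_simps)
  have "mat_mult_over A0_AP_plus_ring A B = mat_one_over A0_AP_plus_ring n \<longleftrightarrow>
      (\<forall>i<n. \<forall>j<n. mat_mult_over A0_AP_plus_ring A B $$ (i, j) = mat_one_over A0_AP_plus_ring n $$ (i, j))"
    using cA cB by (auto simp: mat_eq_iff mat_mult_over_def mat_one_over_def)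
  also have "\<dots> \<longleftrightarrow> (\<forall>i<n. \<forall>j<n. \<forall>s\<in>closed_rhp. (eval_mat A s * eval_mat B s) $$ (i, j) = 1\<^sub>m n $$ (i, j))"
  proof -
    have "restrict f closed_rhp = restrict g closed_rhp \<longleftrightarrow> (\<forall>s\<in>closed_rhp. f s = g s)"
      for f g :: "complex \<Rightarrow> complex"
      by (auto simp: fun_eq_iff restrict_def)
    then show ?thesis using entry one by simp
  qed
  also have "\<dots> \<longleftrightarrow> (\<forall>s\<in>closed_rhp. eval_mat A s * eval_mat B s = 1\<^sub>m n)"
  proof -
    have "M = 1\<^sub>m n \<longleftrightarrow> (\<forall>i<n. \<forall>j<n. M $$ (i, j) = 1\<^sub>m n $$ (i, j))" if "M \<in> carrier_mat n n"
      for M :: "complex mat"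
      using that by (auto simp: mat_eq_iff)
    from this[OF mult_carrier_mat[OF ec]] show ?thesis by blast
  qed
  finally show ?thesis .
qed

theorem corollary5p5:
  shows "hermite_ring A0_AP_plus_ring"
  unfolding hermite_ring_def
proof (intro conjI allI impI)
  show "ring A0_AP_plus_ring" by (rule ring_A0_AP_plus)
  fix k n f
  assume "k < n" and "left_invertible_over A0_AP_plus_ring n k f"
  then obtain g where f: "f \<in> matrices_over A0_AP_plus_ring n k"
    and g: "g \<in> matrices_over A0_AP_plus_ring k n"
    and gf: "mat_mult_over A0_AP_plus_ring g f = mat_one_over A0_AP_plus_ring k"
    unfolding left_invertible_over_def by blast
  have "completable n k (eval_mat f)"
  proof -
    obtain p q where "AP_part_mat n k (eval_mat f) p" "AP_part_mat k n (eval_mat g) q"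
      using eval_mat_AP_part f g by blast
    moreover have "eval_mat g s * eval_mat f s = 1\<^sub>m k" if "s \<in> closed_rhp" for s
      using gf mat_mult_over_eq_one_iff[OF g f] that by blast
    ultimately show ?thesis using \<open>k < n\<close> by (intro completable_left_invertible) auto
  qed
  then obtain F P G Q where F: "AP_part_mat n n F P" and G: "AP_part_mat n n G Q"
    and GF: "\<forall>s\<in>closed_rhp. G s * F s = 1\<^sub>m n \<and> (\<forall>i<n. \<forall>j<k. F s $$ (i, j) = eval_mat f s $$ (i, j))"
    unfolding completable_def by blast
  note F' = restrict_mat_matrices_over[OF F] and G' = restrict_mat_matrices_over[OF G]
  have "mat_mult_over A0_AP_plus_ring (restrict_mat n n G) (restrict_mat n n F) = mat_one_over A0_AP_plus_ring n"
    using GF eval_restrict_mat[OF F] eval_restrict_mat[OF G] by (simp add: mat_mult_over_eq_one_iff[OF G' F'])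
  moreover have "restrict_mat n n F $$ (i, j) = f $$ (i, j)" if ij: "i < n" "j < k" for i j
  proof (rule extensionalityI[of _ closed_rhp])
    show "restrict_mat n n F $$ (i, j) \<in> extensional closed_rhp"
      using ij \<open>k < n\<close> by (simp add: restrict_mat_def)
    show "f $$ (i, j) \<in> extensional closed_rhp"
      using f ij by (simp add: matrices_over_A0_AP_plus_iff A0_AP_plus_extensional)
    fix s assume "s \<in> closed_rhp"
    then show "(restrict_mat n n F $$ (i, j)) s = (f $$ (i, j)) s"
      using GF f ij \<open>k < n\<close> by (auto simp: restrict_mat_def eval_mat_def matrices_over_A0_AP_plus_iff)
  qed
  ultimately show "\<exists>F\<in>matrices_over A0_AP_plus_ring n n. \<exists>G\<in>matrices_over A0_AP_plus_ring n n.
      mat_mult_over A0_AP_plus_ring G F = mat_one_over A0_AP_plus_ring n \<and>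
      (\<forall>i<n. \<forall>j<k. F $$ (i, j) = f $$ (i, j))"
    using F' G' by blast
qed

end
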